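(* Let $b=\{b_I\}_{I\in\mathcal D}$ and $d=\{d_I\}_{I\in\mathcal D}$ be sequences of complex numbers indexed by the dyadic intervals. The composition $\mathsf P_b^{(0,1)}\circ\mathsf P_d^{(1,0)}$ is bounded on $L^2(\mathbb R)$ if and only if both $$\left\|\mathsf Q_I\mathsf P_b^{(0,1)}\mathsf P_d^{(1,0)}(\mathsf Q_I\overline d)\right\|_{L^2(\mathbb R)}^2\le C_1^2\left\|\mathsf Q_Id\right\|_{L^2(\mathbb R)}^2,\qquad \left\|\mathsf Q_I\mathsf P_d^{(0,1)}\mathsf P_b^{(1,0)}(\mathsf Q_I\overline b)\right\|_{L^2(\mathbb R)}^2\le C_2^2\left\|\mathsf Q_Ib\right\|_{L^2(\mathbb R)}^2$$ for all $I\in\mathcal D$; i.e. for all $I\in\mathcal D$ the following inequalities are true: $$\sum_{J\subset I}|b_J|^2\frac1{|J|^2}\Big(\sum_{L\subset J}|d_L|^2\Big)^2\le C_1^2\sum_{L\subset I}|d_L|^2,\qquad \sum_{J\subset I}|d_J|^2\frac1{|J|^2}\Big(\sum_{L\subset J}|b_L|^2\Big)^2\le C_2^2\sum_{L\subset I}|b_L|^2.$$ Moreover, the norm of $\mathsf P_b^{(0,1)}\circ\mathsf P_d^{(1,0)}$ on $L^2(\mathbb R)$ satisfies $$\left\|\mathsf P_b^{(0,1)}\circ\mathsf P_d^{(1,0)}\right\|_{L^2(\mathbb R)\to L^2(\mathbb R)}\approx C_1+C_2,$$ where $C_1$ and $C_2$ are the best constants appearing above.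
   Context: $\mathcal D$ is the usual grid of dyadic intervals on $\mathbb R$; $I_-$ and $I_+$ are the left and right halves of $I$; $J\subset I$ allows $J=I$. For $I\in\mathcal D$, $h_I=h_I^0=|I|^{-1/2}(-\mathbf 1_{I_-}+\mathbf 1_{I_+})$ and $h_I^1=|I|^{-1}\mathbf 1_I$. For a complex sequence $b=\{b_I\}_{I\in\mathcal D}$ and $(\alpha,\beta)\in\{0,1\}\times\{0,1\}$, the dyadic paraproduct acting on a function $f$ is $$\mathsf P_b^{(\alpha,\beta)}f=\sum_{I\in\mathcal D}b_I\langle f,h_I^\beta\rangle_{L^2(\mathbb R)}h_I^\alpha .$$ $\overline b=\{\overline{b_I}\}_{I\in\mathcal D}$. For $f\in L^2(\mathbb R)$ and $I\in\mathcal D$, $\mathsf Q_If=\sum_{J\subset I}\langle f,h_J\rangle_{L^2(\mathbb R)}h_J$ is the projection onto the span of the Haar functions supported within $I$; for a sequence $a=\{a_J\}_{J\in\mathcal D}$, $\mathsf Q_Ia=\sum_{J\subset I}a_Jh_J$. In the conditions, $C_1$ and $C_2$ are finite constants independent of $I$. $A\approx B$ means $cB\le A\le CB$ with absolute constants $0<c\le C<\infty$.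
   Formalization: The sequences b and d are assumed square summable over the dyadic subintervals of each dyadic I, so that Q_I b and Q_I d lie in L^2; for arbitrary sequences the norms in the conditions may be undefined and the equivalence can fail. *)

theory Defs
  imports "HOL-Analysis.Analysis"
begin

definition dyadic :: "real set set" where
  "dyadic = {I. \<exists>k m :: int. I = {of_int m * 2 powi k ..< (of_int m + 1) * 2 powi k}}"

abbreviation len :: "real set \<Rightarrow> real" where
  "len I \<equiv> measure lborel I"

definition left_half :: "real set \<Rightarrow> real set" where
  "left_half I = {x \<in> I. x < Inf I + len I / 2}"

definition right_half :: "real set \<Rightarrow> real set" where
  "right_half I = {x \<in> I. Inf I + len I / 2 \<le> x}"

definition dyadic_below :: "real set \<Rightarrow> real set set" where
  "dyadic_below I = {J \<in> dyadic. J \<subseteq> I}"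

text \<open>The upper index 0 gives the cancellative Haar function, any other index (in practice 1)
  the averaging function.\<close>

definition haar :: "nat \<Rightarrow> real set \<Rightarrow> real \<Rightarrow> complex" where
  "haar \<alpha> I x =
     (if \<alpha> = 0
      then of_real ((indicator (right_half I) x - indicator (left_half I) x) / sqrt (len I))
      else of_real (indicator I x / len I))"

text \<open>Elements of \<open>L\<^sup>2(\<real>)\<close> are represented by Borel functions, equality being equality almost
  everywhere.\<close>

definition L2 :: "(real \<Rightarrow> complex) set" where
  "L2 = {f \<in> borel_measurable lborel. integrable lborel (\<lambda>x. (cmod (f x))\<^sup>2)}"

definition L2_norm :: "(real \<Rightarrow> complex) \<Rightarrow> real" where
  "L2_norm f = sqrt (LINT x|lborel. (cmod (f x))\<^sup>2)"

definition pairing :: "(real \<Rightarrow> complex) \<Rightarrow> (real \<Rightarrow> complex) \<Rightarrow> complex" where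
  "pairing f g = (LINT x|lborel. f x * cnj (g x))"

definition has_L2_sum ::
  "(real set \<Rightarrow> real \<Rightarrow> complex) \<Rightarrow> real set set \<Rightarrow> (real \<Rightarrow> complex) \<Rightarrow> bool" where
  "has_L2_sum u A g \<longleftrightarrow> g \<in> L2 \<and>
     ((\<lambda>F. L2_norm (\<lambda>x. g x - (\<Sum>J\<in>F. u J x))) \<longlongrightarrow> 0) (finite_subsets_at_top A)"

text \<open>\<open>Q_seq I a\<close> is the sum of \<open>a\<^sub>J h\<^sub>J\<close> over \<open>J \<subseteq> I\<close>; it is determined up to a null set as soon as
  \<open>a\<close> is square summable below \<open>I\<close>. For \<open>f\<close> in \<open>L\<^sup>2\<close>, \<open>Q_fun I f\<close> is the projection of \<open>f\<close>.\<close>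

definition Q_seq :: "real set \<Rightarrow> (real set \<Rightarrow> complex) \<Rightarrow> real \<Rightarrow> complex" where
  "Q_seq I a = (SOME g. has_L2_sum (\<lambda>J x. a J * haar 0 J x) (dyadic_below I) g)"

definition Q_fun :: "real set \<Rightarrow> (real \<Rightarrow> complex) \<Rightarrow> real \<Rightarrow> complex" where
  "Q_fun I f = Q_seq I (\<lambda>J. pairing f (haar 0 J))"

definition locally_integrable :: "(real \<Rightarrow> complex) \<Rightarrow> bool" where
  "locally_integrable g \<longleftrightarrow> (\<forall>r s. set_integrable lborel {r..s} g)"

text \<open>\<open>is_paraproduct \<alpha> \<beta> b f g\<close> says that the series defining the paraproduct of type
  \<open>(\<alpha>, \<beta>)\<close> with symbol \<open>b\<close>, applied to \<open>f\<close>, converges unconditionally to \<open>g\<close> in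
  \<open>L\<^sup>1\<close> on bounded intervals. This is weak enough to apply the inner factor of the composition to
  functions of the form \<open>Q_seq I a\<close>, where the series need not converge in \<open>L\<^sup>2\<close>, and strong enough
  to determine \<open>g\<close> almost everywhere and to pair it with the functions \<open>haar \<beta> I\<close>.\<close>

definition is_paraproduct ::
  "nat \<Rightarrow> nat \<Rightarrow> (real set \<Rightarrow> complex) \<Rightarrow> (real \<Rightarrow> complex) \<Rightarrow> (real \<Rightarrow> complex) \<Rightarrow> bool" where
  "is_paraproduct \<alpha> \<beta> b f g \<longleftrightarrow> locally_integrable g \<and>
     (\<forall>r s. ((\<lambda>F. LINT x:{r..s}|lborel.
                cmod (g x - (\<Sum>I\<in>F. b I * pairing f (haar \<beta> I) * haar \<alpha> I x))) \<longlongrightarrow> 0)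
             (finite_subsets_at_top dyadic))"

definition is_composition ::
  "(real set \<Rightarrow> complex) \<Rightarrow> (real set \<Rightarrow> complex) \<Rightarrow> (real \<Rightarrow> complex) \<Rightarrow> (real \<Rightarrow> complex) \<Rightarrow> bool" where
  "is_composition b d f u \<longleftrightarrow> (\<exists>g. is_paraproduct 1 0 d f g \<and> is_paraproduct 0 1 b g u)"

definition haar_span :: "(real \<Rightarrow> complex) set" where
  "haar_span = {f. \<exists>F c. finite F \<and> F \<subseteq> dyadic \<and> f = (\<lambda>x. \<Sum>J\<in>F. c J * haar 0 J x)}"

text \<open>For general symbols the composition is a priori defined only on the finite linear
  combinations of Haar functions, which are dense in \<open>L\<^sup>2\<close>. It is bounded by \<open>C\<close> if it extends to a
  linear operator \<open>T\<close> on \<open>L\<^sup>2\<close> with norm at most \<open>C\<close>; by density \<open>T\<close> is then unique.\<close>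

definition composition_bounded_by ::
  "(real set \<Rightarrow> complex) \<Rightarrow> (real set \<Rightarrow> complex) \<Rightarrow> real \<Rightarrow> bool" where
  "composition_bounded_by b d C \<longleftrightarrow>
     (\<exists>T. (\<forall>f\<in>L2. T f \<in> L2 \<and> L2_norm (T f) \<le> C * L2_norm f) \<and>
          (\<forall>f\<in>L2. \<forall>g\<in>L2. \<forall>a. AE x in lborel. T (\<lambda>y. a * f y + g y) x = a * T f x + T g x) \<and>
          (\<forall>f\<in>haar_span. is_composition b d f (T f)))"

definition composition_bounded ::
  "(real set \<Rightarrow> complex) \<Rightarrow> (real set \<Rightarrow> complex) \<Rightarrow> bool" where
  "composition_bounded b d \<longleftrightarrow> (\<exists>C. composition_bounded_by b d C)"

definition composition_norm ::
  "(real set \<Rightarrow> complex) \<Rightarrow> (real set \<Rightarrow> complex) \<Rightarrow> real" where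
  "composition_norm b d = Inf {C. 0 \<le> C \<and> composition_bounded_by b d C}"

text \<open>This says that \<open>Q_seq I a\<close> exists in \<open>L\<^sup>2\<close> for every dyadic \<open>I\<close>, so that its norm in the testing
  conditions is meaningful. It cannot be replaced by allowing infinite sums: if only \<open>b\<^sub>J\<close> is nonzero
  and \<open>d\<close> is supported strictly below \<open>J\<close> and not square summable there, the composition is
  unbounded, but each testing inequality reads \<open>0 \<le> 0\<close>, \<open>0 \<le> \<infinity>\<close> or \<open>\<infinity> \<le> \<infinity>\<close>.\<close>

definition locally_square_summable :: "(real set \<Rightarrow> complex) \<Rightarrow> bool" where
  "locally_square_summable a \<longleftrightarrow>
     (\<forall>I\<in>dyadic. (\<lambda>L. (cmod (a L))\<^sup>2) summable_on dyadic_below I)"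

definition operator_testing ::
  "(real set \<Rightarrow> complex) \<Rightarrow> (real set \<Rightarrow> complex) \<Rightarrow> real \<Rightarrow> bool" where
  "operator_testing b d C \<longleftrightarrow>
     (\<forall>I\<in>dyadic. \<exists>u\<in>L2. is_composition b d (Q_seq I (\<lambda>J. cnj (d J))) u \<and>
        (L2_norm (Q_fun I u))\<^sup>2 \<le> C\<^sup>2 * (L2_norm (Q_seq I d))\<^sup>2)"

text \<open>The summability clause says that the left-hand side is finite; without it \<open>infsum\<close> would
  return 0 for a divergent sum.\<close>

definition sum_testing ::
  "(real set \<Rightarrow> complex) \<Rightarrow> (real set \<Rightarrow> complex) \<Rightarrow> real \<Rightarrow> bool" where
  "sum_testing b d C \<longleftrightarrow>
     (\<forall>I\<in>dyadic.
        (\<lambda>J. (cmod (b J))\<^sup>2 * (1 / (len J)\<^sup>2) *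
             (\<Sum>\<^sub>\<infinity>L\<in>dyadic_below J. (cmod (d L))\<^sup>2)\<^sup>2) summable_on dyadic_below I \<and>
        (\<Sum>\<^sub>\<infinity>J\<in>dyadic_below I. (cmod (b J))\<^sup>2 * (1 / (len J)\<^sup>2) *
             (\<Sum>\<^sub>\<infinity>L\<in>dyadic_below J. (cmod (d L))\<^sup>2)\<^sup>2)
          \<le> C\<^sup>2 * (\<Sum>\<^sub>\<infinity>L\<in>dyadic_below I. (cmod (d L))\<^sup>2))"

definition best_constant :: "(real \<Rightarrow> bool) \<Rightarrow> real" where
  "best_constant P = Inf {C. 0 \<le> C \<and> P C}"

end

theory Submission
  imports Defs
begin

text \<open>On Haar coefficients the composition acts by the matrix \<open>b\<^sub>J d\<^sub>I |I \<inter> J| / (|I| |J|)\<close>. Up to the phases of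
  the symbols its entries are nonnegative, so it is bounded if and only if the nonnegative bilinear form with the
  moduli is, and the form is symmetric in \<open>b\<close> and \<open>d\<close>. Since dyadic intervals are nested or disjoint, the form
  splits into the part \<open>I \<subseteq> J\<close> and the part \<open>J \<subseteq> I\<close>. Each is a two-weight Hardy operator on the dyadic
  tree, and its norm is at most twice the constant of its own sum testing condition. Conversely, applying a bounded
  form to the moduli of \<open>d\<close> below \<open>I\<close> gives operator testing, whose left-hand side dominates that of sum
  testing because all entries are nonnegative.\<close>

section \<open>Completeness of \<open>L\<^sup>1\<close> and \<open>L\<^sup>2\<close>\<close>

text \<open>The obstacle is the inner factor: its series need not converge in L2, so the composition
  cannot simply be formed inside L2. The outer factor, however, sees the intermediate function only
  through its pairings with \<open>haar 1 J\<close>, and for these unconditional L1 convergence on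
  bounded intervals is enough. The output is then a Haar series whose coefficients are the explicit
  sums \<open>row_sum\<close>, and operator and testing conditions are compared through these
  coefficients alone. The test function carries the conjugate of \<open>d\<close> because its
  products with the symbol are |d_L|^2. This makes the inner series absolutely summable, and it
  makes every row nonnegative up to the single factor \<open>b J\<close>, so that discarding terms
  of a row can only decrease its modulus. The factor 2 in the Hardy inequality is that of the
  product rule: passing from a potential to its square, an increment is multiplied by at most twice
  the potential.\<close>

lemma norm_diff_power_le:
  fixes a b :: complex
  assumes "p = 1 \<or> p = 2"
  shows "cmod (a - b) ^ p \<le> 2 * (cmod a ^ p + cmod b ^ p)"
  using assms
proof
  assume p: "p = 2"
  have "cmod (a - b) ^ 2 \<le> (cmod a + cmod b) ^ 2"
    by (intro power_mono norm_triangle_ineq4) auto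
  also have "\<dots> \<le> 2 * (cmod a ^ 2 + cmod b ^ 2)"
    using sum_squares_bound[of "cmod a" "cmod b"] by (simp add: power2_sum)
  finally show ?thesis using p by simp
next
  assume p: "p = 1"
  have "cmod (a - b) \<le> cmod a + cmod b" by (rule norm_triangle_ineq4)
  also have "\<dots> \<le> 2 * (cmod a + cmod b)" by simp
  finally show ?thesis using p by simp
qed

lemma ennreal_norm_diff_power_le:
  fixes a b :: complex
  assumes "p = 1 \<or> p = 2"
  shows "ennreal (cmod (a - b) ^ p) \<le> ennreal 2 * (ennreal (cmod a ^ p) + ennreal (cmod b ^ p))"
proof -
  have "ennreal 2 * (ennreal (cmod a ^ p) + ennreal (cmod b ^ p))
      = ennreal (2 * (cmod a ^ p + cmod b ^ p))"
    by (subst ennreal_plus[symmetric]) (auto simp only: ennreal_mult norm_ge_zero zero_le_power add_nonneg_nonneg zero_le_numeral)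
  thus ?thesis using norm_diff_power_le[OF assms] by (simp only: ennreal_leI)
qed

lemma ennreal_suminf_finite_bound:
  fixes a :: "nat \<Rightarrow> real"
  assumes "(\<Sum>k. ennreal (a k)) \<noteq> top"
  obtains B where "B \<ge> 0" "\<And>k. a k \<le> B"
proof
  define T where "T = (\<Sum>k. ennreal (a k))"
  have T: "T = ennreal (enn2real T)"
    using assms by (simp add: T_def ennreal_enn2real_if)
  show "enn2real T \<ge> 0" by simp
  show "a k \<le> enn2real T" for k
  proof -
    have "(\<Sum>i\<in>{k}. ennreal (a i)) \<le> T"
      unfolding T_def by (rule sum_le_suminf) auto
    hence "ennreal (a k) \<le> ennreal (enn2real T)" using T by simp
    thus ?thesis by (subst (asm) ennreal_le_iff) auto
  qed
qed

text \<open>A finite weighted sum bounds every single term, so the p-th powers of the increments are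
  O(4^(-k)). The base 4 leaves the summable rate 2^(-k) after the square root taken for p =
  2.\<close>

lemma convergent_of_weighted_increments:
  fixes s :: "nat \<Rightarrow> complex"
  assumes p: "p = 1 \<or> p = 2"
    and fin: "(\<Sum>k. ennreal (4 ^ k * cmod (s (Suc k) - s k) ^ p)) \<noteq> \<infinity>"
  shows "convergent s"
proof -
  obtain B where B: "B \<ge> 0" and bound: "\<And>k. 4 ^ k * cmod (s (Suc k) - s k) ^ p \<le> B"
    using ennreal_suminf_finite_bound[OF fin[unfolded infinity_ennreal_def]] by blast
  \<comment> \<open>The constant \<open>B + 1\<close> dominates both \<open>B\<close>, which arises
    for p = 1, and the square root of \<open>B\<close>, which arises for p = 2.\<close>
  have inc: "cmod (s (Suc k) - s k) \<le> (B + 1) * (1/2) ^ k" for k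
    using p
  proof
    assume "p = 1"
    hence "cmod (s (Suc k) - s k) \<le> B * (1/4) ^ k"
      using bound[of k] by (simp add: field_simps)
    also have "\<dots> \<le> (B + 1) * (1/2) ^ k"
      using B by (intro mult_mono power_mono) auto
    finally show ?thesis .
  next
    assume "p = 2"
    have "(2 ^ k * cmod (s (Suc k) - s k)) ^ 2 = (2 ^ 2) ^ k * cmod (s (Suc k) - s k) ^ 2"
      by (simp only: power_mult_distrib flip: power_mult, simp only: mult.commute)
    also have "\<dots> \<le> B" using bound[of k] \<open>p = 2\<close> by simp
    also have "\<dots> \<le> (B + 1) ^ 2" using B by (simp add: power2_sum)
    finally have "2 ^ k * cmod (s (Suc k) - s k) \<le> B + 1"
      by (rule power2_le_imp_le) (use B in auto)
    thus ?thesis by (simp add: field_simps)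
  qed
  have "summable (\<lambda>k. (B + 1) * (1/2::real) ^ k)"
    by (intro summable_mult summable_geometric) auto
  hence "summable (\<lambda>k. s (Suc k) - s k)"
    by (rule summable_comparison_test[rotated]) (use inc in auto)
  hence "convergent (\<lambda>n. \<Sum>k<n. s (Suc k) - s k)"
    by (simp add: summable_iff_convergent)
  hence "convergent (\<lambda>n. s n - s 0)" by (simp add: sum_lessThan_telescope)
  thus ?thesis by (simp add: convergent_diff_const_right_iff)
qed

text \<open>An unconditional form of completeness of \<open>L\<^sup>1\<close> and \<open>L\<^sup>2\<close>: the sum is the almost everywhere
  limit along finite sets whose tails decay geometrically, and Fatou's lemma controls the remainder
  of every finite partial sum.\<close>

lemma unconditional_sum_exists:
  fixes e :: "'i \<Rightarrow> 'a \<Rightarrow> complex" and w :: "'i \<Rightarrow> real" and p :: nat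
  assumes p: "p = 1 \<or> p = 2"
    and meas: "\<And>J. J \<in> A \<Longrightarrow> e J \<in> borel_measurable M"
    and w: "w summable_on A" "\<And>J. J \<in> A \<Longrightarrow> 0 \<le> w J"
    and H: "\<And>F. finite F \<Longrightarrow> F \<subseteq> A \<Longrightarrow>
              (\<integral>\<^sup>+x. ennreal (cmod (\<Sum>J\<in>F. e J x) ^ p) \<partial>M) \<le> ennreal (\<Sum>J\<in>F. w J)"
  shows "\<exists>g \<in> borel_measurable M. \<forall>F. finite F \<longrightarrow> F \<subseteq> A \<longrightarrow>
       (\<integral>\<^sup>+x. ennreal (cmod (g x - (\<Sum>J\<in>F. e J x)) ^ p) \<partial>M)
         \<le> ennreal (2 * (infsum w A - sum w F))"
proof -
  \<comment> \<open>The error (1/8)^k is chosen against the weight 4^k of the increments; their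
    product is the summable (1/2)^k.\<close>
  have "\<forall>k. \<exists>F. finite F \<and> F \<subseteq> A \<and> dist (sum w F) (infsum w A) \<le> (1/8) ^ k"
    using infsum_finite_approximation[OF w(1)] by simp
  then obtain F0 where F0: "\<And>k. finite (F0 k)" "\<And>k. F0 k \<subseteq> A"
      "\<And>k. dist (sum w (F0 k)) (infsum w A) \<le> (1/8) ^ k"
    by metis
  \<comment> \<open>Unions make the sets increase, so that successive partial sums differ by a sum
    over \<open>Fk (Suc k) - Fk k\<close>. As the weights are nonnegative, enlarging
    \<open>F0 k\<close> keeps its tail bound.\<close>
  define Fk where "Fk k = (\<Union>i\<le>k. F0 i)" for k
  have Fk: "finite (Fk k)" "Fk k \<subseteq> A" "Fk k \<subseteq> Fk (Suc k)" "F0 k \<subseteq> Fk k" for k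
    unfolding Fk_def using F0 by (auto simp: le_Suc_eq)
  have tail: "sum w (G - F) \<le> infsum w A - sum w F"
    if "finite G" "G \<subseteq> A" "finite F" "F \<subseteq> A" for G F
  proof -
    have "sum w (G - F) + sum w F = sum w ((G - F) \<union> F)"
      by (rule sum.union_disjoint[symmetric]) (use that in auto)
    also have "\<dots> \<le> infsum w A"
      by (rule finite_sum_le_infsum) (use that w in auto)
    finally show ?thesis by simp
  qed
  have tailk: "sum w (G - Fk k) \<le> (1/8) ^ k" if "finite G" "G \<subseteq> A" for G k
  proof -
    have "sum w (G - Fk k) \<le> sum w (G - F0 k)"
      by (rule sum_mono2) (use that Fk w in \<open>auto simp: subset_iff\<close>)
    also have "\<dots> \<le> infsum w A - sum w (F0 k)"
      by (rule tail) (use that F0 in auto)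
    also have "\<dots> \<le> (1/8) ^ k" using F0(3)[of k] by (simp add: dist_real_def)
    finally show ?thesis .
  qed
  define s where "s k x = (\<Sum>J\<in>Fk k. e J x)" for k x
  have s_meas [measurable]: "s k \<in> borel_measurable M" for k
    unfolding s_def by (intro borel_measurable_sum meas) (use Fk in auto)
  have S_meas: "(\<lambda>x. \<Sum>J\<in>F. e J x) \<in> borel_measurable M" if "F \<subseteq> A" for F
    by (intro borel_measurable_sum meas) (use that in auto)
  have inc: "s (Suc k) x - s k x = (\<Sum>J\<in>Fk (Suc k) - Fk k. e J x)" for k x
    unfolding s_def using Fk by (subst sum_diff) auto
  have "(\<integral>\<^sup>+x. (\<Sum>k. ennreal (4 ^ k * cmod (s (Suc k) x - s k x) ^ p)) \<partial>M)
      = (\<Sum>k. \<integral>\<^sup>+x. ennreal (4 ^ k * cmod (s (Suc k) x - s k x) ^ p) \<partial>M)"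
    by (rule nn_integral_suminf) simp
  also have "\<dots> \<le> (\<Sum>k. ennreal ((1/2) ^ k))"
  proof (rule suminf_le)
    fix k
    have "(\<integral>\<^sup>+x. ennreal (4 ^ k * cmod (s (Suc k) x - s k x) ^ p) \<partial>M)
        = ennreal (4 ^ k) * (\<integral>\<^sup>+x. ennreal (cmod (s (Suc k) x - s k x) ^ p) \<partial>M)"
      by (subst nn_integral_cmult[symmetric]) (auto simp: ennreal_mult)
    also have "\<dots> \<le> ennreal (4 ^ k) * ennreal (sum w (Fk (Suc k) - Fk k))"
      unfolding inc by (intro mult_left_mono H) (use Fk in auto)
    also have "\<dots> \<le> ennreal (4 ^ k) * ennreal ((1/8) ^ k)"
      by (intro mult_left_mono ennreal_leI tailk Fk) auto
    also have "\<dots> = ennreal ((1/2) ^ k)"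
      by (simp flip: ennreal_mult power_mult_distrib)
    finally show "(\<integral>\<^sup>+x. ennreal (4 ^ k * cmod (s (Suc k) x - s k x) ^ p) \<partial>M)
        \<le> ennreal ((1/2) ^ k)" .
  qed auto
  also have "\<dots> < \<infinity>"
    by (subst suminf_ennreal2) (auto intro: summable_geometric)
  finally have "(\<integral>\<^sup>+x. (\<Sum>k. ennreal (4 ^ k * cmod (s (Suc k) x - s k x) ^ p)) \<partial>M) \<noteq> \<infinity>"
    by simp
  hence "AE x in M. (\<Sum>k. ennreal (4 ^ k * cmod (s (Suc k) x - s k x) ^ p)) \<noteq> \<infinity>"
    by (intro nn_integral_PInf_AE) auto
  hence "AE x in M. convergent (\<lambda>k. s k x)"
    by eventually_elim (rule convergent_of_weighted_increments[OF p])
  define g where "g x = lim (\<lambda>k. s k x)" for x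
  have g_meas [measurable]: "g \<in> borel_measurable M"
    unfolding g_def by measurable
  have lim: "AE x in M. (\<lambda>k. s k x) \<longlonglongrightarrow> g x"
    using \<open>AE x in M. convergent (\<lambda>k. s k x)\<close>
    by eventually_elim (simp add: g_def convergent_LIMSEQ_iff)
  have "(\<integral>\<^sup>+x. ennreal (cmod (g x - (\<Sum>J\<in>F. e J x)) ^ p) \<partial>M)
         \<le> ennreal (2 * (infsum w A - sum w F))" if F: "finite F" "F \<subseteq> A" for F
  proof -
    note S_meas[OF F(2), measurable]
    let ?S = "\<lambda>x. \<Sum>J\<in>F. e J x"
    have "(\<integral>\<^sup>+x. ennreal (cmod (g x - ?S x) ^ p) \<partial>M)
        = (\<integral>\<^sup>+x. liminf (\<lambda>k. ennreal (cmod (s k x - ?S x) ^ p)) \<partial>M)"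
    proof (rule nn_integral_cong_AE)
      show "AE x in M. ennreal (cmod (g x - ?S x) ^ p) = liminf (\<lambda>k. ennreal (cmod (s k x - ?S x) ^ p))"
        using lim
      proof eventually_elim
        case (elim x)
        have "(\<lambda>k. ennreal (cmod (s k x - ?S x) ^ p)) \<longlonglongrightarrow> ennreal (cmod (g x - ?S x) ^ p)"
          by (intro tendsto_ennrealI tendsto_intros elim)
        thus ?case by (intro lim_imp_Liminf[symmetric]) auto
      qed
    qed
    also have "\<dots> \<le> liminf (\<lambda>k. \<integral>\<^sup>+x. ennreal (cmod (s k x - ?S x) ^ p) \<partial>M)"
      by (rule nn_integral_liminf) simp
    also have "\<dots> \<le> liminf (\<lambda>k. ennreal (2 * ((infsum w A - sum w F) + (1/8) ^ k)))"
    proof (rule Liminf_mono, rule always_eventually, rule allI)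
      fix k
      \<comment> \<open>The terms common to \<open>Fk k\<close> and \<open>F\<close> cancel. What is
        left of \<open>Fk k\<close> is bounded by the remainder of \<open>F\<close>, and what is
        left of \<open>F\<close> by (1/8)^k, which vanishes in the limit.\<close>
      let ?a = "\<lambda>x. \<Sum>J\<in>Fk k - F. e J x" and ?b = "\<lambda>x. \<Sum>J\<in>F - Fk k. e J x"
      have m: "?a \<in> borel_measurable M" "?b \<in> borel_measurable M"
        using S_meas[of "Fk k - F"] S_meas[of "F - Fk k"] Fk F by blast+
      have split: "s k x - ?S x = ?a x - ?b x" for x
      proof -
        have "s k x = ?a x + (\<Sum>J\<in>Fk k \<inter> F. e J x)"
          unfolding s_def using Fk(1)[of k]
          by (subst sum.union_disjoint[symmetric]) (auto intro!: sum.cong)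
        moreover have "?S x = ?b x + (\<Sum>J\<in>Fk k \<inter> F. e J x)"
          using F(1) by (subst sum.union_disjoint[symmetric]) (auto intro!: sum.cong)
        ultimately show ?thesis by simp
      qed
      have "(\<integral>\<^sup>+x. ennreal (cmod (s k x - ?S x) ^ p) \<partial>M)
          \<le> (\<integral>\<^sup>+x. ennreal 2 * (ennreal (cmod (?a x) ^ p) + ennreal (cmod (?b x) ^ p)) \<partial>M)"
        unfolding split
        by (intro nn_integral_mono ennreal_norm_diff_power_le[OF p])
      also have "\<dots> = ennreal 2 * ((\<integral>\<^sup>+x. ennreal (cmod (?a x) ^ p) \<partial>M)
                                 + (\<integral>\<^sup>+x. ennreal (cmod (?b x) ^ p) \<partial>M))"
        using m by (subst nn_integral_cmult, measurable, subst nn_integral_add) auto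
      also have "\<dots> \<le> ennreal 2 * (ennreal (sum w (Fk k - F)) + ennreal (sum w (F - Fk k)))"
        by (intro mult_left_mono add_mono H) (use Fk F in auto)
      also have "\<dots> \<le> ennreal 2 * (ennreal (infsum w A - sum w F) + ennreal ((1/8) ^ k))"
        by (intro mult_left_mono add_mono ennreal_leI tail tailk) (use Fk F in auto)
      also have "\<dots> = ennreal 2 * ennreal ((infsum w A - sum w F) + (1/8) ^ k)"
        using tail[of "{}" F] F by (subst ennreal_plus) auto
      also have "\<dots> = ennreal (2 * ((infsum w A - sum w F) + (1/8) ^ k))"
        using tail[of "{}" F] F by (intro ennreal_mult[symmetric]) auto
      finally show "(\<integral>\<^sup>+x. ennreal (cmod (s k x - ?S x) ^ p) \<partial>M)
          \<le> ennreal (2 * ((infsum w A - sum w F) + (1/8) ^ k))" .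
    qed
    also have "\<dots> = ennreal (2 * ((infsum w A - sum w F) + 0))"
      by (intro lim_imp_Liminf tendsto_ennrealI tendsto_intros LIMSEQ_power_zero) auto
    finally show ?thesis by simp
  qed
  with g_meas show ?thesis by blast
qed

section \<open>Square integrable functions and orthonormal families\<close>

lemma measurable_cnj [measurable]: "cnj \<in> borel_measurable borel"
  by (intro borel_measurable_continuous_onI continuous_intros)

lemma L2_measurable [measurable_dest]: "f \<in> L2 \<Longrightarrow> f \<in> borel_measurable lborel"
  by (simp add: L2_def)

lemma L2_integrable: "f \<in> L2 \<Longrightarrow> integrable lborel (\<lambda>x. (cmod (f x))\<^sup>2)"
  by (simp add: L2_def)

lemma L2_norm_nonneg [simp]: "0 \<le> L2_norm f"
  by (simp add: L2_norm_def)

lemma L2_norm_power2: "(L2_norm f)\<^sup>2 = (LINT x|lborel. (cmod (f x))\<^sup>2)"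
  by (simp add: L2_norm_def)

lemma L2_zero [simp]: "(\<lambda>x. 0) \<in> L2"
  by (simp add: L2_def)

lemma L2_scale: "f \<in> L2 \<Longrightarrow> (\<lambda>x. c * f x) \<in> L2"
  by (auto simp: L2_def norm_mult power_mult_distrib)

lemma cmod_add_power2_le: "(cmod (a + b))\<^sup>2 \<le> 2 * (cmod a)\<^sup>2 + 2 * (cmod b)\<^sup>2"
  using norm_diff_power_le[of 2 a "- b"] by simp

lemma L2_add:
  assumes "f \<in> L2" "g \<in> L2"
  shows "(\<lambda>x. f x + g x) \<in> L2"
proof -
  have [measurable]: "f \<in> borel_measurable lborel" "g \<in> borel_measurable lborel"
    using assms by (auto dest: L2_measurable)
  have "integrable lborel (\<lambda>x. (cmod (f x + g x))\<^sup>2)"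
    by (rule Bochner_Integration.integrable_bound[of _ "\<lambda>x. 2 * (cmod (f x))\<^sup>2 + 2 * (cmod (g x))\<^sup>2"])
       (auto intro!: AE_I2 L2_integrable assms cmod_add_power2_le)
  thus ?thesis by (simp add: L2_def)
qed

lemma L2_diff: "f \<in> L2 \<Longrightarrow> g \<in> L2 \<Longrightarrow> (\<lambda>x. f x - g x) \<in> L2"
  using L2_add[of f "\<lambda>x. -1 * g x"] L2_scale[of g "-1"] by simp

lemma L2_sum:
  assumes "\<And>i. i \<in> F \<Longrightarrow> u i \<in> L2"
  shows "(\<lambda>x. \<Sum>i\<in>F. u i x) \<in> L2"
  using assms by (induction F rule: infinite_finite_induct) (auto intro: L2_add)

text \<open>A quasi-triangle inequality in place of Minkowski's. It is applied to errors that tend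
  to zero, where the factor 2 is harmless.\<close>

lemma L2_norm_add_power2_le:
  assumes "f \<in> L2" "g \<in> L2"
  shows "(L2_norm (\<lambda>x. f x + g x))\<^sup>2 \<le> 2 * (L2_norm f)\<^sup>2 + 2 * (L2_norm g)\<^sup>2"
proof -
  have "(LINT x|lborel. (cmod (f x + g x))\<^sup>2)
      \<le> (LINT x|lborel. 2 * (cmod (f x))\<^sup>2 + 2 * (cmod (g x))\<^sup>2)"
    by (intro integral_mono cmod_add_power2_le Bochner_Integration.integrable_add
          integrable_mult_right L2_integrable L2_add assms)
  also have "\<dots> = 2 * (L2_norm f)\<^sup>2 + 2 * (L2_norm g)\<^sup>2"
    by (simp add: L2_norm_power2 L2_integrable assms)
  finally show ?thesis by (simp add: L2_norm_power2)
qed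

lemma L2_norm_scale: "L2_norm (\<lambda>x. c * f x) = cmod c * L2_norm f"
  by (simp add: L2_norm_def norm_mult power_mult_distrib real_sqrt_mult)

lemma integrable_cmod_mult_L2:
  assumes "f \<in> L2" "g \<in> L2"
  shows "integrable lborel (\<lambda>x. cmod (f x) * cmod (g x))"
proof -
  have [measurable]: "f \<in> borel_measurable lborel" "g \<in> borel_measurable lborel"
    using assms by (auto dest: L2_measurable)
  have bd: "cmod (f x) * cmod (g x) \<le> (cmod (f x))\<^sup>2 + (cmod (g x))\<^sup>2" for x
    using sum_squares_bound[of "cmod (f x)" "cmod (g x)"]
      mult_nonneg_nonneg[OF norm_ge_zero norm_ge_zero, of "f x" "g x"] by linarith
  show ?thesis
    by (rule Bochner_Integration.integrable_bound[of _ "\<lambda>x. (cmod (f x))\<^sup>2 + (cmod (g x))\<^sup>2"])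
       (auto intro!: AE_I2 L2_integrable assms bd)
qed

lemma integrable_mult_cnj_L2:
  assumes "f \<in> L2" "g \<in> L2"
  shows "integrable lborel (\<lambda>x. f x * cnj (g x))"
proof -
  have [measurable]: "f \<in> borel_measurable lborel" "g \<in> borel_measurable lborel"
    using assms by (auto dest: L2_measurable)
  show ?thesis
    by (rule Bochner_Integration.integrable_bound[OF integrable_cmod_mult_L2[OF assms]])
       (auto simp: norm_mult)
qed

lemma L2_Cauchy_Schwarz:
  assumes "f \<in> L2" "g \<in> L2"
  shows "(LINT x|lborel. cmod (f x) * cmod (g x)) \<le> L2_norm f * L2_norm g"
proof -
  have [measurable]: "f \<in> borel_measurable lborel" "g \<in> borel_measurable lborel"
    using assms by (auto dest: L2_measurable)
  let ?I = "LINT x|lborel. cmod (f x) * cmod (g x)"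
  have I: "0 \<le> ?I" by (intro integral_nonneg_AE) auto
  have "ennreal (?I\<^sup>2) = (ennreal ?I)\<^sup>2"
    using I by (simp add: ennreal_power)
  also have "ennreal ?I = (\<integral>\<^sup>+x. ennreal (cmod (f x)) * ennreal (cmod (g x)) \<partial>lborel)"
    by (subst nn_integral_eq_integral[symmetric])
       (auto intro!: integrable_cmod_mult_L2 assms simp: ennreal_mult)
  also have "\<dots>\<^sup>2 \<le> (\<integral>\<^sup>+x. ennreal (cmod (f x)) ^ 2 \<partial>lborel) * (\<integral>\<^sup>+x. ennreal (cmod (g x)) ^ 2 \<partial>lborel)"
    by (rule Cauchy_Schwarz_nn_integral) auto
  also have "\<dots> = ennreal ((L2_norm f)\<^sup>2) * ennreal ((L2_norm g)\<^sup>2)"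
    by (simp add: ennreal_power L2_norm_power2 nn_integral_eq_integral L2_integrable assms)
  also have "\<dots> = ennreal ((L2_norm f * L2_norm g)\<^sup>2)"
    by (simp add: ennreal_mult power_mult_distrib)
  finally have "?I\<^sup>2 \<le> (L2_norm f * L2_norm g)\<^sup>2"
    by (subst (asm) ennreal_le_iff) auto
  thus ?thesis by (rule power2_le_imp_le) simp
qed

lemma cmod_pairing_le:
  assumes "f \<in> L2" "g \<in> L2"
  shows "cmod (pairing f g) \<le> L2_norm f * L2_norm g"
proof -
  have "cmod (pairing f g) \<le> (LINT x|lborel. cmod (f x * cnj (g x)))"
    unfolding pairing_def by (rule integral_norm_bound)
  also have "\<dots> \<le> L2_norm f * L2_norm g"
    using L2_Cauchy_Schwarz[OF assms] by (simp add: norm_mult)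
  finally show ?thesis .
qed

lemma pairing_add_left:
  "f \<in> L2 \<Longrightarrow> f' \<in> L2 \<Longrightarrow> g \<in> L2 \<Longrightarrow>
     pairing (\<lambda>x. f x + f' x) g = pairing f g + pairing f' g"
  by (simp add: pairing_def ring_distribs integrable_mult_cnj_L2)

lemma pairing_diff_left:
  "f \<in> L2 \<Longrightarrow> f' \<in> L2 \<Longrightarrow> g \<in> L2 \<Longrightarrow>
     pairing (\<lambda>x. f x - f' x) g = pairing f g - pairing f' g"
  by (simp add: pairing_def ring_distribs integrable_mult_cnj_L2)

lemma pairing_scale_left: "pairing (\<lambda>x. c * f x) g = c * pairing f g"
  by (simp add: pairing_def mult.assoc)

lemma pairing_sum_left:
  assumes "\<And>i. i \<in> F \<Longrightarrow> u i \<in> L2" "g \<in> L2"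
  shows "pairing (\<lambda>x. \<Sum>i\<in>F. u i x) g = (\<Sum>i\<in>F. pairing (u i) g)"
  using assms
  by (induction F rule: infinite_finite_induct)
     (auto simp: pairing_add_left L2_sum pairing_def[of "\<lambda>x. 0"])

lemma pairing_commute: "pairing f g = cnj (pairing g f)"
  unfolding pairing_def by (subst Bochner_Integration.integral_cnj[symmetric]) (simp add: mult.commute)

lemma pairing_self: "pairing f f = of_real ((L2_norm f)\<^sup>2)"
  by (simp add: pairing_def L2_norm_power2 complex_norm_square[symmetric]
        flip: of_real_power integral_complex_of_real)

lemma pairing_sum_right:
  assumes "\<And>i. i \<in> F \<Longrightarrow> u i \<in> L2" "g \<in> L2"
  shows "pairing g (\<lambda>x. \<Sum>i\<in>F. c i * u i x) = (\<Sum>i\<in>F. cnj (c i) * pairing g (u i))"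
proof -
  have "pairing g (\<lambda>x. \<Sum>i\<in>F. c i * u i x) = cnj (\<Sum>i\<in>F. pairing (\<lambda>x. c i * u i x) g)"
    using assms by (subst pairing_commute) (simp add: pairing_sum_left L2_scale)
  also have "\<dots> = (\<Sum>i\<in>F. cnj (c i) * pairing g (u i))"
    by (simp add: pairing_scale_left pairing_commute[of g])
  finally show ?thesis .
qed

lemma has_L2_sum_in_L2: "has_L2_sum u A g \<Longrightarrow> g \<in> L2"
  by (simp add: has_L2_sum_def)

lemma has_L2_sum_tendsto_power2:
  "has_L2_sum u A g \<Longrightarrow>
     ((\<lambda>F. (L2_norm (\<lambda>x. g x - (\<Sum>J\<in>F. u J x)))\<^sup>2) \<longlongrightarrow> 0) (finite_subsets_at_top A)"
  unfolding has_L2_sum_def using tendsto_power[of _ 0 _ 2] by fastforce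

lemma has_L2_sumI:
  assumes "g \<in> L2"
    and "((\<lambda>F. (L2_norm (\<lambda>x. g x - (\<Sum>J\<in>F. u J x)))\<^sup>2) \<longlongrightarrow> 0) (finite_subsets_at_top A)"
  shows "has_L2_sum u A g"
  using assms tendsto_real_sqrt[OF assms(2)] by (simp add: has_L2_sum_def)

text \<open>Both functions are compared with the same partial sums. Values of the operator built
  later are chosen representatives, and this is what turns linearity of their coefficients into
  linearity almost everywhere.\<close>

lemma has_L2_sum_unique:
  assumes u: "\<And>J. J \<in> A \<Longrightarrow> u J \<in> L2" and g: "has_L2_sum u A g" and g': "has_L2_sum u A g'"
  shows "AE x in lborel. g x = g' x"
proof -
  let ?d = "\<lambda>x. g x - g' x"
  let ?S = "\<lambda>F x. \<Sum>J\<in>F. u J x"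
  note L = has_L2_sum_in_L2[OF g] has_L2_sum_in_L2[OF g']
  have [measurable]: "g \<in> borel_measurable lborel" "g' \<in> borel_measurable lborel"
    using L by (auto dest: L2_measurable)
  have "((\<lambda>F. 2 * (L2_norm (\<lambda>x. g x - ?S F x))\<^sup>2 + 2 * (L2_norm (\<lambda>x. g' x - ?S F x))\<^sup>2) \<longlongrightarrow> 2 * 0 + 2 * 0)
          (finite_subsets_at_top A)"
    by (intro tendsto_intros has_L2_sum_tendsto_power2 g g')
  moreover have "\<forall>\<^sub>F F in finite_subsets_at_top A. (L2_norm ?d)\<^sup>2
      \<le> 2 * (L2_norm (\<lambda>x. g x - ?S F x))\<^sup>2 + 2 * (L2_norm (\<lambda>x. g' x - ?S F x))\<^sup>2"
  proof (rule eventually_finite_subsets_at_top_weakI)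
    fix F assume F: "finite F" "F \<subseteq> A"
    have S: "?S F \<in> L2" using F u by (auto intro: L2_sum)
    have "(L2_norm (\<lambda>x. (g x - ?S F x) + (-1) * (g' x - ?S F x)))\<^sup>2
       \<le> 2 * (L2_norm (\<lambda>x. g x - ?S F x))\<^sup>2 + 2 * (L2_norm (\<lambda>x. (-1) * (g' x - ?S F x)))\<^sup>2"
      by (intro L2_norm_add_power2_le L2_scale L2_diff L S)
    thus "(L2_norm ?d)\<^sup>2 \<le> 2 * (L2_norm (\<lambda>x. g x - ?S F x))\<^sup>2 + 2 * (L2_norm (\<lambda>x. g' x - ?S F x))\<^sup>2"
      unfolding L2_norm_scale by simp
  qed
  ultimately have "(L2_norm ?d)\<^sup>2 \<le> 2 * 0 + 2 * 0"
    by (rule tendsto_lowerbound) simp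
  hence "(LINT x|lborel. (cmod (?d x))\<^sup>2) = 0"
    by (simp add: L2_norm_power2[symmetric])
  hence "AE x in lborel. (cmod (?d x))\<^sup>2 = 0"
    using integral_nonneg_eq_0_iff_AE[OF L2_integrable[OF L2_diff[OF L]]] by simp
  thus ?thesis by eventually_elim simp
qed

lemma has_L2_sum_linear:
  assumes u: "\<And>J. J \<in> A \<Longrightarrow> u J \<in> L2" "\<And>J. J \<in> A \<Longrightarrow> v J \<in> L2"
    and f: "has_L2_sum u A f" and g: "has_L2_sum v A g"
  shows "has_L2_sum (\<lambda>J x. a * u J x + v J x) A (\<lambda>x. a * f x + g x)"
proof (rule has_L2_sumI)
  note L = has_L2_sum_in_L2[OF f] has_L2_sum_in_L2[OF g]
  show "(\<lambda>x. a * f x + g x) \<in> L2" by (intro L2_add L2_scale L)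
  let ?U = "\<lambda>F x. \<Sum>J\<in>F. u J x" and ?V = "\<lambda>F x. \<Sum>J\<in>F. v J x"
  let ?e = "\<lambda>F. (L2_norm (\<lambda>x. a * f x + g x - (\<Sum>J\<in>F. a * u J x + v J x)))\<^sup>2"
  have "((\<lambda>F. 2 * ((cmod a)\<^sup>2 * (L2_norm (\<lambda>x. f x - ?U F x))\<^sup>2) + 2 * (L2_norm (\<lambda>x. g x - ?V F x))\<^sup>2)
          \<longlongrightarrow> 2 * ((cmod a)\<^sup>2 * 0) + 2 * 0) (finite_subsets_at_top A)"
    by (intro tendsto_intros has_L2_sum_tendsto_power2 f g)
  hence lim: "((\<lambda>F. 2 * ((cmod a)\<^sup>2 * (L2_norm (\<lambda>x. f x - ?U F x))\<^sup>2) + 2 * (L2_norm (\<lambda>x. g x - ?V F x))\<^sup>2)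
          \<longlongrightarrow> 0) (finite_subsets_at_top A)" by simp
  have le: "\<forall>\<^sub>F F in finite_subsets_at_top A. ?e F
      \<le> 2 * ((cmod a)\<^sup>2 * (L2_norm (\<lambda>x. f x - ?U F x))\<^sup>2) + 2 * (L2_norm (\<lambda>x. g x - ?V F x))\<^sup>2"
  proof (rule eventually_finite_subsets_at_top_weakI)
    fix F assume F: "finite F" "F \<subseteq> A"
    have S: "?U F \<in> L2" "?V F \<in> L2" using F u by (auto intro!: L2_sum)
    have "(L2_norm (\<lambda>x. a * (f x - ?U F x) + (g x - ?V F x)))\<^sup>2
       \<le> 2 * (L2_norm (\<lambda>x. a * (f x - ?U F x)))\<^sup>2 + 2 * (L2_norm (\<lambda>x. g x - ?V F x))\<^sup>2"
      by (intro L2_norm_add_power2_le L2_scale L2_diff L S)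
    moreover have "(\<lambda>x. a * f x + g x - (\<Sum>J\<in>F. a * u J x + v J x))
        = (\<lambda>x. a * (f x - ?U F x) + (g x - ?V F x))"
      by (simp add: sum.distrib sum_distrib_left algebra_simps)
    ultimately show "?e F
      \<le> 2 * ((cmod a)\<^sup>2 * (L2_norm (\<lambda>x. f x - ?U F x))\<^sup>2) + 2 * (L2_norm (\<lambda>x. g x - ?V F x))\<^sup>2"
      by (simp only: L2_norm_scale power_mult_distrib)
  qed
  show "(?e \<longlongrightarrow> 0) (finite_subsets_at_top A)"
    by (rule tendsto_sandwich[OF _ le tendsto_const lim]) simp
qed

lemma has_L2_sum_cong:
  assumes "\<And>J. J \<in> A \<Longrightarrow> u J = v J"
  shows "has_L2_sum u A g \<longleftrightarrow> has_L2_sum v A g"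
proof -
  have "((\<lambda>F. L2_norm (\<lambda>x. g x - (\<Sum>J\<in>F. u J x))) \<longlongrightarrow> 0) (finite_subsets_at_top A)
    \<longleftrightarrow> ((\<lambda>F. L2_norm (\<lambda>x. g x - (\<Sum>J\<in>F. v J x))) \<longlongrightarrow> 0) (finite_subsets_at_top A)"
    using assms
    by (intro tendsto_cong eventually_finite_subsets_at_top_weakI arg_cong[where f = L2_norm] ext
          arg_cong2[where f = "(-)"] refl sum.cong) auto
  thus ?thesis by (simp add: has_L2_sum_def)
qed

section \<open>Bessel, Parseval and Riesz--Fischer for orthonormal families\<close>

locale orthonormal_family =
  fixes e :: "real set \<Rightarrow> real \<Rightarrow> complex" and D :: "real set set"
  assumes in_L2: "I \<in> D \<Longrightarrow> e I \<in> L2"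
    and pairing_eq: "I \<in> D \<Longrightarrow> J \<in> D \<Longrightarrow> pairing (e I) (e J) = (if I = J then 1 else 0)"
begin

lemma pairing_sum:
  assumes "finite F" "F \<subseteq> D" "J \<in> D"
  shows "pairing (\<lambda>x. \<Sum>I\<in>F. c I * e I x) (e J) = (if J \<in> F then c J else 0)"
proof -
  have "pairing (\<lambda>x. \<Sum>I\<in>F. c I * e I x) (e J) = (\<Sum>I\<in>F. c I * (if I = J then 1 else 0))"
    using assms by (subst pairing_sum_left)
      (auto intro!: L2_scale in_L2 sum.cong simp: pairing_scale_left pairing_eq)
  also have "\<dots> = (\<Sum>I\<in>F. if I = J then c J else 0)"
    by (intro sum.cong) auto
  finally show ?thesis using assms by simp
qed

lemma sum_in_L2: "F \<subseteq> D \<Longrightarrow> (\<lambda>x. \<Sum>I\<in>F. c I * e I x) \<in> L2"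
  by (intro L2_sum L2_scale in_L2) auto

lemma L2_norm_sum:
  assumes "finite F" "F \<subseteq> D"
  shows "(L2_norm (\<lambda>x. \<Sum>I\<in>F. c I * e I x))\<^sup>2 = (\<Sum>I\<in>F. (cmod (c I))\<^sup>2)"
proof -
  let ?S = "\<lambda>x. \<Sum>I\<in>F. c I * e I x"
  have "complex_of_real ((L2_norm ?S)\<^sup>2) = (\<Sum>I\<in>F. cnj (c I) * pairing ?S (e I))"
    using assms sum_in_L2[OF assms(2)] by (subst pairing_self[symmetric], subst pairing_sum_right)
      (auto intro: in_L2)
  also have "\<dots> = (\<Sum>I\<in>F. c I * cnj (c I))"
    using assms by (intro sum.cong) (auto simp: pairing_sum subset_iff)
  also have "\<dots> = complex_of_real (\<Sum>I\<in>F. (cmod (c I))\<^sup>2)"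
    by (simp add: complex_norm_square[symmetric])
  finally show ?thesis unfolding of_real_eq_iff .
qed

text \<open>Pythagoras: the remainder is orthogonal to each \<open>e I\<close> with \<open>I\<close>
  in \<open>F\<close>, hence to the partial sum itself. Bessel's inequality is the nonnegativity of
  the left-hand side.\<close>

lemma L2_norm_diff_projection:
  assumes g: "g \<in> L2" and F: "finite F" "F \<subseteq> D"
  shows "(L2_norm (\<lambda>x. g x - (\<Sum>I\<in>F. pairing g (e I) * e I x)))\<^sup>2
       = (L2_norm g)\<^sup>2 - (\<Sum>I\<in>F. (cmod (pairing g (e I)))\<^sup>2)"
proof -
  let ?c = "\<lambda>I. pairing g (e I)"
  let ?S = "\<lambda>x. \<Sum>I\<in>F. ?c I * e I x"
  note S = sum_in_L2[OF F(2), of ?c]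
  have orth: "pairing (\<lambda>x. g x - ?S x) ?S = 0"
  proof -
    have "pairing (\<lambda>x. g x - ?S x) ?S = (\<Sum>I\<in>F. cnj (?c I) * pairing (\<lambda>x. g x - ?S x) (e I))"
      by (rule pairing_sum_right) (use F in \<open>auto intro: in_L2 L2_diff g S\<close>)
    also have "\<dots> = (\<Sum>I\<in>F. 0)"
    proof (rule sum.cong)
      fix I assume "I \<in> F"
      hence "I \<in> D" using F by auto
      hence "pairing (\<lambda>x. g x - ?S x) (e I) = 0"
        using \<open>I \<in> F\<close> F by (subst pairing_diff_left) (auto simp: pairing_sum intro: g S in_L2)
      thus "cnj (?c I) * pairing (\<lambda>x. g x - ?S x) (e I) = 0" by simp
    qed simp
    finally show ?thesis by simp
  qed
  have "pairing (\<lambda>x. g x - ?S x) g = pairing g g - pairing ?S g"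
    by (rule pairing_diff_left) (intro g S)+
  moreover have "pairing (\<lambda>x. g x - ?S x) (\<lambda>x. g x - ?S x)
      = cnj (pairing g (\<lambda>x. g x - ?S x) - pairing ?S (\<lambda>x. g x - ?S x))"
    by (subst pairing_commute, subst pairing_diff_left) (auto intro: g S L2_diff)
  hence "pairing (\<lambda>x. g x - ?S x) (\<lambda>x. g x - ?S x) = pairing (\<lambda>x. g x - ?S x) g"
    using orth pairing_commute[of "\<lambda>x. g x - ?S x" ?S] pairing_commute[of "\<lambda>x. g x - ?S x" g] by simp
  moreover have "pairing ?S g = (\<Sum>I\<in>F. ?c I * pairing (e I) g)"
    using F by (subst pairing_sum_left) (auto simp: pairing_scale_left intro!: L2_scale in_L2 g)
  moreover have "(\<Sum>I\<in>F. ?c I * pairing (e I) g) = complex_of_real (\<Sum>I\<in>F. (cmod (?c I))\<^sup>2)"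
    unfolding of_real_sum
    by (intro sum.cong refl) (subst (2) pairing_commute, simp add: complex_norm_square[symmetric])
  ultimately have "complex_of_real ((L2_norm (\<lambda>x. g x - ?S x))\<^sup>2)
     = complex_of_real ((L2_norm g)\<^sup>2 - (\<Sum>I\<in>F. (cmod (?c I))\<^sup>2))"
    by (simp only: pairing_self of_real_diff)
  thus ?thesis unfolding of_real_eq_iff .
qed

lemma Bessel_finite:
  assumes "g \<in> L2" "finite F" "F \<subseteq> D"
  shows "(\<Sum>I\<in>F. (cmod (pairing g (e I)))\<^sup>2) \<le> (L2_norm g)\<^sup>2"
  using L2_norm_diff_projection[OF assms] by (smt (verit) zero_le_power2)

lemma Bessel_summable:
  assumes "g \<in> L2" "A \<subseteq> D"
  shows "(\<lambda>I. (cmod (pairing g (e I)))\<^sup>2) summable_on A"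
  using assms Bessel_finite[OF assms(1)]
  by (intro nonneg_bdd_above_summable_on bdd_aboveI2[where M = "(L2_norm g)\<^sup>2"]) auto

lemma Bessel_infsum:
  assumes "g \<in> L2" "A \<subseteq> D"
  shows "(\<Sum>\<^sub>\<infinity>I\<in>A. (cmod (pairing g (e I)))\<^sup>2) \<le> (L2_norm g)\<^sup>2"
  using assms by (intro infsum_le_finite_sums Bessel_summable Bessel_finite) auto

text \<open>By Cauchy--Schwarz, pairing with \<open>e J\<close> is continuous along the partial
  sums, and the coefficient of the partial sums at \<open>J\<close> is eventually constant.\<close>

lemma has_L2_sum_pairing:
  assumes g: "has_L2_sum (\<lambda>I x. c I * e I x) A g" and A: "A \<subseteq> D" and J: "J \<in> D"
  shows "pairing g (e J) = (if J \<in> A then c J else 0)"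
proof -
  let ?S = "\<lambda>F x. \<Sum>I\<in>F. c I * e I x"
  note gL = has_L2_sum_in_L2[OF g]
  define v where "v = (if J \<in> A then c J else 0)"
  have "((\<lambda>F. L2_norm (\<lambda>x. g x - ?S F x) * L2_norm (e J)) \<longlongrightarrow> 0 * L2_norm (e J)) (finite_subsets_at_top A)"
    using g unfolding has_L2_sum_def by (intro tendsto_intros) auto
  moreover have "\<forall>\<^sub>F F in finite_subsets_at_top A.
      cmod (pairing g (e J) - v) \<le> L2_norm (\<lambda>x. g x - ?S F x) * L2_norm (e J)"
    unfolding eventually_finite_subsets_at_top
  \<comment> \<open>The coefficient is constant once the finite set contains \<open>J\<close>, if
    \<open>J\<close> lies in \<open>A\<close> at all; otherwise it is 0 from the start. The
    threshold \<open>A \<inter> {J}\<close> covers both cases.\<close>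
  proof (intro exI[of _ "A \<inter> {J}"] conjI allI impI)
    fix F assume F: "finite F \<and> A \<inter> {J} \<subseteq> F \<and> F \<subseteq> A"
    hence FD: "finite F" "F \<subseteq> D" using A by auto
    have "pairing (?S F) (e J) = v"
      using F by (subst pairing_sum[OF FD J]) (auto simp: v_def)
    hence "pairing g (e J) - v = pairing (\<lambda>x. g x - ?S F x) (e J)"
      by (subst pairing_diff_left) (auto intro: gL sum_in_L2[OF FD(2)] in_L2 J)
    thus "cmod (pairing g (e J) - v) \<le> L2_norm (\<lambda>x. g x - ?S F x) * L2_norm (e J)"
      using cmod_pairing_le[of "\<lambda>x. g x - ?S F x" "e J"] gL sum_in_L2[OF FD(2)] in_L2[OF J]
      by (simp add: L2_diff)
  qed auto
  ultimately have "cmod (pairing g (e J) - v) \<le> 0 * L2_norm (e J)"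
    by (rule tendsto_lowerbound) simp
  thus ?thesis by (simp add: v_def)
qed

text \<open>Parseval without completeness of the family: since \<open>g\<close> is the sum of its
  series, the projection error in Pythagoras' identity tends to zero.\<close>

lemma has_L2_sum_norm:
  assumes g: "has_L2_sum (\<lambda>I x. c I * e I x) A g" and A: "A \<subseteq> D"
  shows "((\<lambda>I. (cmod (c I))\<^sup>2) has_sum (L2_norm g)\<^sup>2) A"
proof -
  note gL = has_L2_sum_in_L2[OF g]
  have "((\<lambda>F. (L2_norm g)\<^sup>2 - (L2_norm (\<lambda>x. g x - (\<Sum>I\<in>F. c I * e I x)))\<^sup>2) \<longlongrightarrow> (L2_norm g)\<^sup>2 - 0)
          (finite_subsets_at_top A)"
    by (intro tendsto_intros has_L2_sum_tendsto_power2 g)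
  moreover have "\<forall>\<^sub>F F in finite_subsets_at_top A.
     (L2_norm g)\<^sup>2 - (L2_norm (\<lambda>x. g x - (\<Sum>I\<in>F. c I * e I x)))\<^sup>2 = (\<Sum>I\<in>F. (cmod (c I))\<^sup>2)"
  proof (rule eventually_finite_subsets_at_top_weakI)
    fix F assume F: "finite F" "F \<subseteq> A"
    have c: "pairing g (e I) = c I" if "I \<in> F" for I
      using has_L2_sum_pairing[OF g A, of I] that F A by (auto simp: subset_iff)
    have "(\<lambda>x. g x - (\<Sum>I\<in>F. c I * e I x)) = (\<lambda>x. g x - (\<Sum>I\<in>F. pairing g (e I) * e I x))"
      by (simp add: c)
    moreover have "(\<Sum>I\<in>F. (cmod (pairing g (e I)))\<^sup>2) = (\<Sum>I\<in>F. (cmod (c I))\<^sup>2)"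
      by (simp add: c)
    ultimately show "(L2_norm g)\<^sup>2 - (L2_norm (\<lambda>x. g x - (\<Sum>I\<in>F. c I * e I x)))\<^sup>2 = (\<Sum>I\<in>F. (cmod (c I))\<^sup>2)"
      using L2_norm_diff_projection[OF gL F(1)] F A by auto
  qed
  ultimately show ?thesis
    unfolding has_sum_def by (simp add: tendsto_cong)
qed

text \<open>By orthonormality, the squared norm of a finite partial sum equals the sum of the
  weights |c_I|^2, which is the hypothesis of \<open>unconditional_sum_exists\<close> for p = 2. The
  remainder bound given there tends to zero along all finite subsets.\<close>

lemma Riesz_Fischer:
  assumes c: "(\<lambda>I. (cmod (c I))\<^sup>2) summable_on A" and A: "A \<subseteq> D"
  obtains g where "has_L2_sum (\<lambda>I x. c I * e I x) A g"
proof -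
  let ?w = "\<lambda>I. (cmod (c I))\<^sup>2"
  have eq: "(\<integral>\<^sup>+x. ennreal ((cmod (f x))\<^sup>2) \<partial>lborel) = ennreal ((L2_norm f)\<^sup>2)" if "f \<in> L2" for f
    using that by (simp add: L2_norm_power2 nn_integral_eq_integral L2_integrable)
  have meas: "(\<lambda>x. c J * e J x) \<in> borel_measurable lborel" if "J \<in> A" for J
    using that A by (intro L2_measurable L2_scale in_L2) auto
  have bd: "(\<integral>\<^sup>+x. ennreal ((cmod (\<Sum>J\<in>F. c J * e J x))\<^sup>2) \<partial>lborel) \<le> ennreal (\<Sum>J\<in>F. ?w J)"
    if "finite F" "F \<subseteq> A" for F
    using that A by (subst eq) (auto simp: sum_in_L2 L2_norm_sum)
  obtain g where g [measurable]: "g \<in> borel_measurable lborel"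
    and lim: "\<And>F. finite F \<Longrightarrow> F \<subseteq> A \<Longrightarrow>
       (\<integral>\<^sup>+x. ennreal (cmod (g x - (\<Sum>J\<in>F. c J * e J x)) ^ 2) \<partial>lborel) \<le> ennreal (2 * (infsum ?w A - sum ?w F))"
    using unconditional_sum_exists[where p = 2 and e = "\<lambda>J x. c J * e J x" and A = A
          and w = ?w and M = lborel, OF disjI2[OF refl] meas c zero_le_power2 bd] by blast
  have "(\<integral>\<^sup>+x. ennreal ((cmod (g x))\<^sup>2) \<partial>lborel) < \<infinity>"
    using lim[of "{}"] by (auto simp: le_less_trans)
  hence gL: "g \<in> L2"
    unfolding L2_def by (auto intro!: integrableI_bounded)
  have le: "\<forall>\<^sub>F F in finite_subsets_at_top A.
     (L2_norm (\<lambda>x. g x - (\<Sum>J\<in>F. c J * e J x)))\<^sup>2 \<le> 2 * (infsum ?w A - sum ?w F)"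
  proof (rule eventually_finite_subsets_at_top_weakI)
    fix F assume F: "finite F" "F \<subseteq> A"
    hence "sum ?w F \<le> infsum ?w A" by (intro finite_sum_le_infsum c) auto
    moreover have "(\<lambda>x. g x - (\<Sum>J\<in>F. c J * e J x)) \<in> L2"
      using F A by (intro L2_diff gL sum_in_L2) auto
    ultimately show "(L2_norm (\<lambda>x. g x - (\<Sum>J\<in>F. c J * e J x)))\<^sup>2 \<le> 2 * (infsum ?w A - sum ?w F)"
      using lim[OF F] by (simp add: eq)
  qed
  have "((\<lambda>F. 2 * (infsum ?w A - sum ?w F)) \<longlongrightarrow> 2 * (infsum ?w A - infsum ?w A)) (finite_subsets_at_top A)"
    by (intro tendsto_intros infsum_tendsto c)
  hence z: "((\<lambda>F. 2 * (infsum ?w A - sum ?w F)) \<longlongrightarrow> 0) (finite_subsets_at_top A)" by simp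
  have "has_L2_sum (\<lambda>I x. c I * e I x) A g"
    by (rule has_L2_sumI[OF gL tendsto_sandwich[OF _ le tendsto_const z]]) simp
  thus thesis by (rule that)
qed

end

section \<open>Haar functions and paraproducts\<close>

lemma dyadic_cut:
  fixes m q k :: int
  shows "(\<forall>x\<in>{of_int m * 2 powi k ..< (of_int m + 1) * 2 powi k}. x < of_int q * (2 powi k :: real)) \<or>
         (\<forall>x\<in>{of_int m * 2 powi k ..< (of_int m + 1) * 2 powi k}. of_int q * (2 powi k :: real) \<le> x)"
proof (cases "m < q")
  case True
  hence "of_int m + 1 \<le> (of_int q :: real)" by linarith
  hence "(of_int m + 1) * 2 powi k \<le> of_int q * (2 powi k :: real)"
    by (intro mult_right_mono) auto
  thus ?thesis by (meson atLeastLessThan_iff less_le_trans)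
next
  case False
  hence "of_int q \<le> (of_int m :: real)" by simp
  hence "of_int q * 2 powi k \<le> of_int m * (2 powi k :: real)"
    by (intro mult_right_mono) auto
  thus ?thesis by (meson atLeastLessThan_iff order_trans)
qed

lemma powi_multiple:
  fixes k l :: int
  assumes "k \<le> l"
  shows "of_int n * (2 powi l :: real) = of_int (n * 2 ^ nat (l - k)) * 2 powi k"
proof -
  have "(2::real) powi l = 2 powi (l - k) * 2 powi k"
    by (subst power_int_add[symmetric]) auto
  also have "(2::real) powi (l - k) = 2 ^ nat (l - k)"
    using assms by (simp add: power_int_def)
  finally show ?thesis by simp
qed

text \<open>A multiple of the grid step never lies strictly inside a cell, so the whole cell is on
  one side of it. At the scale of \<open>I\<close> this applies to both end points of
  \<open>J\<close> and, if k < l, also to its midpoint (2n + 1) 2^(l-1).\<close>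

lemma dyadic_halves:
  fixes k l m n :: int
  defines "I \<equiv> {of_int m * 2 powi k ..< (of_int m + 1) * 2 powi k :: real}"
  defines "J \<equiv> {of_int n * 2 powi l ..< (of_int n + 1) * 2 powi l :: real}"
  shows "k \<le> l \<Longrightarrow> I \<inter> J = {} \<or> I \<subseteq> J"
    and "k < l \<Longrightarrow> I \<inter> J = {} \<or> I \<subseteq> {of_int n * 2 powi l ..< of_int n * 2 powi l + 2 powi l / 2}
            \<or> I \<subseteq> {of_int n * 2 powi l + 2 powi l / 2 ..< of_int n * 2 powi l + 2 powi l}"
proof -
  have cut: "(\<forall>x\<in>I. x < of_int q * 2 powi j) \<or> (\<forall>x\<in>I. of_int q * 2 powi j \<le> x)" if "k \<le> j" for q j
    unfolding I_def powi_multiple[OF that, of q] by (rule dyadic_cut)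
  have J: "J = {of_int n * 2 powi l ..< of_int n * 2 powi l + 2 powi l}"
    unfolding J_def by (simp add: algebra_simps)
  have e: "of_int (n + 1) * (2 powi l :: real) = of_int n * 2 powi l + 2 powi l"
    by (simp add: algebra_simps)
  show 1: "I \<inter> J = {} \<or> I \<subseteq> J" if "k \<le> l"
    using cut[OF that, of n] cut[OF that, of "n + 1"] unfolding J e by fastforce
  assume "k < l"
  have "(2::real) powi l = 2 powi (l - 1) * 2 powi 1"
    by (subst power_int_add[symmetric]) auto
  hence "of_int (2 * n + 1) * (2 powi (l - 1) :: real) = of_int n * 2 powi l + 2 powi l / 2"
    by (simp add: algebra_simps)
  with cut[of "l - 1" "2 * n + 1"] \<open>k < l\<close>
  have "(\<forall>x\<in>I. x < of_int n * 2 powi l + 2 powi l / 2) \<or> (\<forall>x\<in>I. of_int n * 2 powi l + 2 powi l / 2 \<le> x)"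
    by simp
  thus "I \<inter> J = {} \<or> I \<subseteq> {of_int n * 2 powi l ..< of_int n * 2 powi l + 2 powi l / 2}
            \<or> I \<subseteq> {of_int n * 2 powi l + 2 powi l / 2 ..< of_int n * 2 powi l + 2 powi l}"
    using 1 \<open>k < l\<close> unfolding J by fastforce
qed

lemma dyadic_intervalE:
  assumes "I \<in> dyadic"
  obtains a h where "h > 0" "I = {a..<a + h}" "len I = h"
    "left_half I = {a..<a + h / 2}" "right_half I = {a + h / 2..<a + h}"
proof -
  obtain k m where I: "I = {of_int m * 2 powi k ..< (of_int m + 1) * 2 powi k :: real}"
    using assms by (auto simp: dyadic_def)
  define a h where "a = of_int m * (2 powi k :: real)" and "h = (2 powi k :: real)"
  have h: "h > 0" by (simp add: h_def)
  have I': "I = {a..<a + h}" unfolding I a_def h_def by (simp add: algebra_simps)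
  have "Inf I = a" "len I = h" using h by (auto simp: I' intro!: cInf_atLeastLessThan)
  with h show thesis
    by (intro that[of h a]) (auto simp: I' left_half_def right_half_def)
qed

lemma dyadic_nonempty: "I \<in> dyadic \<Longrightarrow> I \<noteq> {}"
  by (erule dyadic_intervalE) auto

lemma dyadic_len_pos: "I \<in> dyadic \<Longrightarrow> 0 < len I"
  by (erule dyadic_intervalE) auto

lemma dyadic_nested:
  assumes "I \<in> dyadic" "J \<in> dyadic"
  shows "I \<inter> J = {} \<or> I \<subseteq> J \<or> J \<subseteq> I"
proof -
  obtain k m l n where "I = {of_int m * 2 powi k ..< (of_int m + 1) * 2 powi k}"
      "J = {of_int n * 2 powi l ..< (of_int n + 1) * 2 powi l}"
    using assms by (auto simp: dyadic_def)
  thus ?thesis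
    using dyadic_halves(1)[of k l m n] dyadic_halves(1)[of l k n m] by (cases "k \<le> l") auto
qed

lemma dyadic_strict_subset_half:
  assumes "I \<in> dyadic" "J \<in> dyadic" "I \<subset> J"
  shows "I \<subseteq> left_half J \<or> I \<subseteq> right_half J"
proof -
  obtain k m l n where IJ: "I = {of_int m * 2 powi k ..< (of_int m + 1) * 2 powi k}"
      "J = {of_int n * 2 powi l ..< (of_int n + 1) * 2 powi l}"
    using assms by (auto simp: dyadic_def)
  have J: "J = {of_int n * 2 powi l ..< of_int n * 2 powi l + 2 powi l}"
    unfolding IJ by (simp add: algebra_simps)
  have pos: "(2::real) powi l > 0" by simp
  have "Inf J = of_int n * 2 powi l" "len J = 2 powi l"
    using pos unfolding J by (auto intro!: cInf_atLeastLessThan)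
  hence halves: "left_half J = {of_int n * 2 powi l ..< of_int n * 2 powi l + 2 powi l / 2}"
      "right_half J = {of_int n * 2 powi l + 2 powi l / 2 ..< of_int n * 2 powi l + 2 powi l}"
    using pos by (auto simp: left_half_def right_half_def J)
  have ne: "I \<inter> J \<noteq> {}" using dyadic_nonempty[OF assms(1)] assms(3) by auto
  \<comment> \<open>If l were at most k, then \<open>J\<close>, which meets \<open>I\<close>, would
    be contained in \<open>I\<close>, against the strict inclusion.\<close>
  have "k < l"
    using dyadic_halves(1)[of l k n m] assms(3) ne unfolding IJ by fastforce
  from dyadic_halves(2)[OF this, of m n]
  have "I \<inter> J = {} \<or> I \<subseteq> {of_int n * 2 powi l ..< of_int n * 2 powi l + 2 powi l / 2}
      \<or> I \<subseteq> {of_int n * 2 powi l + 2 powi l / 2 ..< of_int n * 2 powi l + 2 powi l}"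
    unfolding IJ .
  with ne show ?thesis by (simp only: halves) simp
qed

lemma cnj_haar [simp]: "cnj (haar \<alpha> I x) = haar \<alpha> I x"
  by (simp add: haar_def)

lemma haar_measurable [measurable]:
  assumes "I \<in> dyadic"
  shows "haar \<alpha> I \<in> borel_measurable borel"
  using assms
proof (rule dyadic_intervalE)
  fix a h :: real
  assume I: "I = {a..<a + h}" "left_half I = {a..<a + h / 2}" "right_half I = {a + h / 2..<a + h}"
  have [measurable]: "I \<in> sets borel" "left_half I \<in> sets borel" "right_half I \<in> sets borel"
    by (subst I, simp)+
  thus ?thesis unfolding haar_def[abs_def] by measurable
qed

lemma haar_bound:
  assumes "I \<in> dyadic"
  obtains B r s where "\<And>x. cmod (haar \<alpha> I x) \<le> B * indicator {r..s} x"
  using assms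
proof (rule dyadic_intervalE)
  fix a h :: real
  assume h: "h > 0" and I: "I = {a..<a + h}" "len I = h"
    "left_half I = {a..<a + h / 2}" "right_half I = {a + h / 2..<a + h}"
  have "cmod (haar \<alpha> I x) \<le> (1 / sqrt h + 1 / h) * indicator {a..a + h} x" for x
    using h I by (auto simp: haar_def indicator_def norm_divide)
  thus thesis by (rule that)
qed

lemma bounded_support_L2:
  assumes [measurable]: "f \<in> borel_measurable borel"
    and le: "\<And>x. cmod (f x) \<le> B * indicator {r..s} x"
  shows "f \<in> L2"
proof -
  have B: "(cmod (f x))\<^sup>2 \<le> B\<^sup>2 * indicator {r..s} x" for x
    using power_mono[OF le[of x] norm_ge_zero, of 2] by (auto simp: indicator_def split: if_splits)
  have "integrable lborel (\<lambda>x. (cmod (f x))\<^sup>2)"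
    by (rule Bochner_Integration.integrable_bound[of _ "\<lambda>x. B\<^sup>2 * indicator {r..s} x"])
       (use B in \<open>auto intro!: AE_I2 integrable_mult_right integrable_real_indicator simp: emeasure_lborel_Icc_eq\<close>)
  thus ?thesis by (simp add: L2_def)
qed

lemma haar_L2:
  assumes "I \<in> dyadic"
  shows "haar \<alpha> I \<in> L2"
proof -
  obtain B r s where "\<And>x. cmod (haar \<alpha> I x) \<le> B * indicator {r..s} x"
    using haar_bound[OF assms] by blast
  thus ?thesis by (rule bounded_support_L2[OF haar_measurable[OF assms]])
qed

lemma pairing_haar1:
  assumes "I \<in> dyadic" "J \<in> dyadic"
  shows "pairing (haar 1 I) (haar 1 J) = of_real (measure lborel (I \<inter> J) / (len I * len J))"
proof -
  have "haar 1 I x * cnj (haar 1 J x) = of_real (indicator (I \<inter> J) x * (1 / (len I * len J)))" for x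
    by (auto simp: haar_def indicator_def)
  hence "pairing (haar 1 I) (haar 1 J) = of_real (LINT x|lborel. indicator (I \<inter> J) x * (1 / (len I * len J)))"
    unfolding pairing_def by (simp only: integral_complex_of_real)
  moreover have "(LINT x|lborel. indicator (I \<inter> J) x * (1 / (len I * len J))) = measure lborel (I \<inter> J) / (len I * len J)"
    by simp
  ultimately show ?thesis by (simp only:)
qed

lemma pairing_haar0_self:
  assumes "I \<in> dyadic"
  shows "pairing (haar 0 I) (haar 0 I) = 1"
  using assms
proof (rule dyadic_intervalE)
  fix a h :: real
  assume h: "h > 0" and I: "I = {a..<a + h}" "len I = h"
    "left_half I = {a..<a + h / 2}" "right_half I = {a + h / 2..<a + h}"
  have "haar 0 I x * cnj (haar 0 I x) = of_real (indicator {a..<a + h} x * (1 / h))" for x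
    using h I(2-) unfolding haar_def by (auto simp: indicator_def simp flip: of_real_mult)
  hence "pairing (haar 0 I) (haar 0 I) = of_real (LINT x|lborel. indicator {a..<a + h} x * (1 / h))"
    unfolding pairing_def by (simp only: integral_complex_of_real)
  thus ?thesis using h by simp
qed

lemma integral_haar0:
  assumes "I \<in> dyadic"
  shows "(LINT x|lborel. haar 0 I x) = 0"
  using assms
proof (rule dyadic_intervalE)
  fix a h :: real
  assume h: "h > 0" and I: "I = {a..<a + h}" "len I = h"
    "left_half I = {a..<a + h / 2}" "right_half I = {a + h / 2..<a + h}"
  have "haar 0 I x = of_real ((indicator {a + h / 2..<a + h} x - indicator {a..<a + h / 2} x) * (1 / sqrt h))" for x
    using I(2-) unfolding haar_def by simp
  hence "(LINT x|lborel. haar 0 I x)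
     = of_real (LINT x|lborel. (indicator {a + h / 2..<a + h} x - indicator {a..<a + h / 2} x) * (1 / sqrt h))"
    by (simp only: integral_complex_of_real)
  also have "(LINT x|lborel. (indicator {a + h / 2..<a + h} x - indicator {a..<a + h / 2} x) * (1 / sqrt h)) = 0"
    using h by (subst integral_mult_left_zero, subst Bochner_Integration.integral_diff) auto
  finally show ?thesis by simp
qed

lemma haar0_outside: "x \<notin> I \<Longrightarrow> haar 0 I x = 0"
  by (auto simp: haar_def left_half_def right_half_def)

text \<open>The smaller interval lies in one half of the larger, where the larger Haar function is
  constant, and the smaller Haar function has mean zero.\<close>

lemma pairing_haar0_strict_subset:
  assumes I: "I \<in> dyadic" and J: "J \<in> dyadic" and "I \<subset> J"
  shows "pairing (haar 0 I) (haar 0 J) = 0"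
proof -
  have disj: "left_half J \<inter> right_half J = {}" by (auto simp: left_half_def right_half_def)
  obtain c where c: "\<And>x. x \<in> I \<Longrightarrow> haar 0 J x = c"
    using dyadic_strict_subset_half[OF assms]
  proof
    assume "I \<subseteq> left_half J"
    hence "haar 0 J x = of_real (- 1 / sqrt (len J))" if "x \<in> I" for x
      using that disj by (auto simp: haar_def indicator_def)
    thus thesis by (rule that)
  next
    assume "I \<subseteq> right_half J"
    hence "haar 0 J x = of_real (1 / sqrt (len J))" if "x \<in> I" for x
      using that disj by (auto simp: haar_def indicator_def)
    thus thesis by (rule that)
  qed
  have "haar 0 I x * cnj (haar 0 J x) = c * haar 0 I x" for x
    using c[of x] haar0_outside[of x I] by (cases "x \<in> I") auto
  hence "pairing (haar 0 I) (haar 0 J) = (LINT x|lborel. c * haar 0 I x)"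
    unfolding pairing_def by (intro Bochner_Integration.integral_cong refl)
  thus ?thesis by (simp add: integral_haar0 I)
qed

interpretation haar: orthonormal_family "haar 0" dyadic
proof
  fix I J assume IJ: "I \<in> dyadic" "J \<in> dyadic"
  show "pairing (haar 0 I) (haar 0 J) = (if I = J then 1 else 0)"
  proof (cases "I = J")
    case False
    with dyadic_nested[OF IJ] consider "I \<inter> J = {}" | "I \<subset> J" | "J \<subset> I" by auto
    hence "pairing (haar 0 I) (haar 0 J) = 0"
    proof cases
      case 1
      hence "haar 0 I x * cnj (haar 0 J x) = 0" for x
        using haar0_outside[of x I] haar0_outside[of x J] by auto
      thus ?thesis by (simp only: pairing_def Bochner_Integration.integral_zero)
    next
      case 2
      thus ?thesis by (rule pairing_haar0_strict_subset[OF IJ])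
    next
      case 3
      show ?thesis
        by (subst pairing_commute) (simp add: pairing_haar0_strict_subset[OF IJ(2,1) 3])
    qed
    thus ?thesis using False by simp
  qed (use IJ pairing_haar0_self in simp)
qed (rule haar_L2)

section \<open>Convergence of paraproduct series\<close>

lemma locally_integrable_bounded_mult:
  assumes g: "locally_integrable g" and [measurable]: "\<phi> \<in> borel_measurable borel"
    and \<phi>: "\<And>x. cmod (\<phi> x) \<le> B * indicator {r..s} x"
  shows "integrable lborel (\<lambda>x. g x * cnj (\<phi> x))"
proof -
  have int: "integrable lborel (\<lambda>x. indicator {r..s} x *\<^sub>R g x)"
    using g by (auto simp: locally_integrable_def set_integrable_def)
  have [measurable]: "(\<lambda>x. indicator {r..s} x *\<^sub>R g x) \<in> borel_measurable lborel"
    using int by (rule borel_measurable_integrable)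
  have eq: "g x * cnj (\<phi> x) = (indicator {r..s} x *\<^sub>R g x) * cnj (\<phi> x)" for x
    using \<phi>[of x] by (auto simp: indicator_def split: if_splits)
  show ?thesis unfolding eq
  proof (rule Bochner_Integration.integrable_bound[of _ "\<lambda>x. B * cmod (indicator {r..s} x *\<^sub>R g x)"])
    show "integrable lborel (\<lambda>x. B * cmod (indicator {r..s} x *\<^sub>R g x))"
      by (intro integrable_mult_right integrable_norm int)
    have "cmod (indicator {r..s} x *\<^sub>R g x * cnj (\<phi> x)) \<le> B * cmod (indicator {r..s} x *\<^sub>R g x)" for x
      using \<phi>[of x] mult_right_mono[of "cmod (\<phi> x)" B "cmod (g x)"]
      by (auto simp: indicator_def norm_mult mult.commute split: if_splits)
    thus "AE x in lborel. norm (indicator {r..s} x *\<^sub>R g x * cnj (\<phi> x))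
        \<le> norm (B * cmod (indicator {r..s} x *\<^sub>R g x))"
      by (intro AE_I2) (simp add: order_trans[OF _ abs_ge_self])
  qed measurable
qed

lemma L2_locally_integrable:
  assumes "f \<in> L2"
  shows "locally_integrable f"
  unfolding locally_integrable_def set_integrable_def
proof (intro allI)
  fix r s :: real
  have "(\<lambda>x. of_real (indicator {r..s} x) :: complex) \<in> L2"
    by (rule bounded_support_L2[of _ 1 r s]) auto
  from integrable_mult_cnj_L2[OF assms this]
  show "integrable lborel (\<lambda>x. indicator {r..s} x *\<^sub>R f x)"
    by (simp add: scaleR_conv_of_real mult.commute)
qed

text \<open>A bounded function supported in [r, s] defines a continuous functional on L1 of that
  interval, which is the topology in which the series converges. Hence the series may be paired term
  by term, for either type of paraproduct.\<close>

lemma paraproduct_pairing: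
  assumes P: "is_paraproduct \<alpha> \<beta> b f g" and [measurable]: "\<phi> \<in> borel_measurable borel"
    and \<phi>: "\<And>x. cmod (\<phi> x) \<le> B * indicator {r..s} x"
  shows "((\<lambda>I. b I * pairing f (haar \<beta> I) * pairing (haar \<alpha> I) \<phi>) has_sum pairing g \<phi>) dyadic"
proof -
  let ?c = "\<lambda>I. b I * pairing f (haar \<beta> I)"
  let ?S = "\<lambda>F x. \<Sum>I\<in>F. ?c I * haar \<alpha> I x"
  have g: "locally_integrable g" using P by (simp add: is_paraproduct_def)
  have \<phi>L: "\<phi> \<in> L2" by (rule bounded_support_L2[OF _ \<phi>]) simp
  have lim: "((\<lambda>F. B * (LINT x:{r..s}|lborel. cmod (g x - ?S F x))) \<longlongrightarrow> B * 0) (finite_subsets_at_top dyadic)"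
    using P unfolding is_paraproduct_def by (intro tendsto_intros) blast
  have le: "\<forall>\<^sub>F F in finite_subsets_at_top dyadic.
      norm ((\<Sum>I\<in>F. ?c I * pairing (haar \<alpha> I) \<phi>) - pairing g \<phi>)
        \<le> B * (LINT x:{r..s}|lborel. cmod (g x - ?S F x))"
  proof (rule eventually_finite_subsets_at_top_weakI)
    fix F :: "real set set" assume F: "finite F" "F \<subseteq> dyadic"
    have S: "?S F \<in> L2" using F by (intro L2_sum L2_scale haar_L2) auto
    have Sl: "locally_integrable (?S F)" by (rule L2_locally_integrable[OF S])
    have dl: "locally_integrable (\<lambda>x. g x - ?S F x)"
      using g Sl by (auto simp: locally_integrable_def intro: set_integral_diff)
    have eq: "(\<Sum>I\<in>F. ?c I * pairing (haar \<alpha> I) \<phi>) = pairing (?S F) \<phi>"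
      using F \<phi>L by (subst pairing_sum_left) (auto intro!: L2_scale haar_L2 simp: pairing_scale_left)
    have "pairing g \<phi> - (\<Sum>I\<in>F. ?c I * pairing (haar \<alpha> I) \<phi>)
         = (LINT x|lborel. g x * cnj (\<phi> x) - ?S F x * cnj (\<phi> x))"
      unfolding eq pairing_def[of g \<phi>] pairing_def[of "?S F" \<phi>]
      by (subst Bochner_Integration.integral_diff)
         (auto intro!: locally_integrable_bounded_mult[OF _ _ \<phi>] g Sl)
    also have "norm \<dots> \<le> (LINT x|lborel. norm (g x * cnj (\<phi> x) - ?S F x * cnj (\<phi> x)))"
      by (rule integral_norm_bound)
    also have "\<dots> \<le> (LINT x|lborel. B * (indicator {r..s} x * cmod (g x - ?S F x)))"
    proof (rule integral_mono)
      show "integrable lborel (\<lambda>x. norm (g x * cnj (\<phi> x) - ?S F x * cnj (\<phi> x)))"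
        by (intro integrable_norm Bochner_Integration.integrable_diff
              locally_integrable_bounded_mult[OF _ _ \<phi>] g Sl) simp_all
      have "integrable lborel (\<lambda>x. indicator {r..s} x *\<^sub>R (g x - ?S F x))"
        using dl by (auto simp: locally_integrable_def set_integrable_def)
      hence "integrable lborel (\<lambda>x. norm (indicator {r..s} x *\<^sub>R (g x - ?S F x)))"
        by (rule integrable_norm)
      thus "integrable lborel (\<lambda>x. B * (indicator {r..s} x * cmod (g x - ?S F x)))"
        by (intro integrable_mult_right) (simp add: norm_mult)
      fix x
      have "norm (g x * cnj (\<phi> x) - ?S F x * cnj (\<phi> x)) = cmod (g x - ?S F x) * cmod (\<phi> x)"
        by (simp flip: left_diff_distrib add: norm_mult)
      also have "\<dots> \<le> cmod (g x - ?S F x) * (B * indicator {r..s} x)"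
        by (intro mult_left_mono \<phi>) simp
      finally show "norm (g x * cnj (\<phi> x) - ?S F x * cnj (\<phi> x))
          \<le> B * (indicator {r..s} x * cmod (g x - ?S F x))" by (simp add: mult_ac)
    qed
    also have "\<dots> = B * (LINT x:{r..s}|lborel. cmod (g x - ?S F x))"
      by (simp add: set_lebesgue_integral_def)
    finally show "norm ((\<Sum>I\<in>F. ?c I * pairing (haar \<alpha> I) \<phi>) - pairing g \<phi>)
        \<le> B * (LINT x:{r..s}|lborel. cmod (g x - ?S F x))"
      by (simp add: norm_minus_commute)
  qed
  have "((\<lambda>F. (\<Sum>I\<in>F. ?c I * pairing (haar \<alpha> I) \<phi>) - pairing g \<phi>) \<longlongrightarrow> 0) (finite_subsets_at_top dyadic)"
    by (rule Lim_null_comparison[OF le]) (use lim in simp)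
  thus ?thesis unfolding has_sum_def by (simp add: LIM_zero_iff)
qed

lemma paraproduct_pairing_haar:
  assumes "is_paraproduct \<alpha> \<beta> b f g" "J \<in> dyadic"
  shows "((\<lambda>I. b I * pairing f (haar \<beta> I) * pairing (haar \<alpha> I) (haar \<gamma> J)) has_sum pairing g (haar \<gamma> J)) dyadic"
  using assms(2)
proof (rule haar_bound[where \<alpha> = \<gamma>])
  fix B r s assume "\<And>x. cmod (haar \<gamma> J x) \<le> B * indicator {r..s} x"
  thus ?thesis by (intro paraproduct_pairing[OF assms(1)] haar_measurable assms(2))
qed

text \<open>When the output series is a Haar series, orthonormality leaves the single term
  \<open>I = J\<close>. No square integrability of \<open>g\<close> or \<open>f\<close> enters, so
  this applies when \<open>f\<close> is the merely locally integrable output of the inner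
  factor.\<close>

lemma paraproduct_haar_coefficient:
  assumes "is_paraproduct 0 \<beta> b f g" "J \<in> dyadic"
  shows "pairing g (haar 0 J) = b J * pairing f (haar \<beta> J)"
proof -
  have "((\<lambda>I. b I * pairing f (haar \<beta> I) * pairing (haar 0 I) (haar 0 J)) has_sum (b J * pairing f (haar \<beta> J))) dyadic"
    by (rule has_sum_finite_neutralI[of "{J}"]) (use assms(2) in \<open>auto simp: haar.pairing_eq\<close>)
  thus ?thesis using paraproduct_pairing_haar[OF assms] has_sum_unique by blast
qed

lemma set_integral_cmod_le_L2:
  assumes "f \<in> L2"
  shows "(LINT x:{r..s}|lborel. cmod (f x)) \<le> L2_norm f * L2_norm (\<lambda>x. of_real (indicator {r..s} x))"
proof -
  have "(\<lambda>x. of_real (indicator {r..s} x) :: complex) \<in> L2"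
    by (rule bounded_support_L2[of _ 1 r s]) auto
  from L2_Cauchy_Schwarz[OF assms this] show ?thesis
    by (simp add: set_lebesgue_integral_def mult.commute)
qed

text \<open>On a bounded interval the L1 norm is at most a constant times the L2 norm, by
  Cauchy--Schwarz against the indicator. Unconditional convergence in L2 is thus stronger than the
  convergence demanded of a paraproduct.\<close>

lemma has_L2_sum_imp_paraproduct:
  assumes u: "has_L2_sum (\<lambda>I x. c I * haar \<alpha> I x) dyadic u"
    and c: "\<And>I. I \<in> dyadic \<Longrightarrow> c I = b I * pairing f (haar \<beta> I)"
  shows "is_paraproduct \<alpha> \<beta> b f u"
  unfolding is_paraproduct_def
proof (intro conjI allI)
  have uL: "u \<in> L2" using u by (rule has_L2_sum_in_L2)
  thus "locally_integrable u" by (rule L2_locally_integrable)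
  fix r s :: real
  let ?S = "\<lambda>F x. \<Sum>I\<in>F. b I * pairing f (haar \<beta> I) * haar \<alpha> I x"
  let ?K = "L2_norm (\<lambda>x. of_real (indicator {r..s} x))"
  have "has_L2_sum (\<lambda>I x. b I * pairing f (haar \<beta> I) * haar \<alpha> I x) dyadic u"
    using u c by (subst has_L2_sum_cong[of _ _ "\<lambda>I x. c I * haar \<alpha> I x"]) auto
  hence "((\<lambda>F. L2_norm (\<lambda>x. u x - ?S F x) * ?K) \<longlongrightarrow> 0 * ?K) (finite_subsets_at_top dyadic)"
    unfolding has_L2_sum_def by (intro tendsto_intros) simp
  hence z: "((\<lambda>F. L2_norm (\<lambda>x. u x - ?S F x) * ?K) \<longlongrightarrow> 0) (finite_subsets_at_top dyadic)" by simp
  have le: "\<forall>\<^sub>F F in finite_subsets_at_top dyadic.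
     (LINT x:{r..s}|lborel. cmod (u x - ?S F x)) \<le> L2_norm (\<lambda>x. u x - ?S F x) * ?K"
    by (rule eventually_finite_subsets_at_top_weakI)
       (intro set_integral_cmod_le_L2 L2_diff uL L2_sum L2_scale haar_L2, auto)
  show "((\<lambda>F. LINT x:{r..s}|lborel. cmod (u x - ?S F x)) \<longlongrightarrow> 0) (finite_subsets_at_top dyadic)"
    by (rule tendsto_sandwich[OF _ le tendsto_const z])
       (auto simp: set_lebesgue_integral_def intro!: always_eventually integral_nonneg_AE)
qed

lemma nn_integral_haar1:
  assumes "I \<in> dyadic"
  shows "(\<integral>\<^sup>+x. ennreal (cmod (haar 1 I x)) \<partial>lborel) = 1"
  using assms
proof (rule dyadic_intervalE)
  fix a h :: real
  assume h: "h > 0" and I: "I = {a..<a + h}" "len I = h"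
  have "ennreal (cmod (haar 1 I x)) = ennreal (1 / h) * indicator {a..<a + h} x" for x
    using h I by (auto simp: haar_def indicator_def norm_divide)
  hence "(\<integral>\<^sup>+x. ennreal (cmod (haar 1 I x)) \<partial>lborel) = ennreal (1 / h) * emeasure lborel {a..<a + h}"
    by (simp add: nn_integral_cmult_indicator)
  also have "\<dots> = 1" using h by (simp flip: ennreal_mult)
  finally show ?thesis .
qed

text \<open>Every \<open>haar 1 I\<close> has L1 norm one, whatever the length of \<open>I\<close>,
  so absolutely summable coefficients give unconditional convergence in L1 of the whole line. Two
  inputs satisfy the hypothesis later: finite Haar combinations, which have finitely many nonzero
  coefficients, and the test functions, for which the coefficients are |d_L|^2 below a fixed
  interval.\<close>

lemma averaging_paraproduct_exists:
  assumes w: "(\<lambda>I. cmod (d I * pairing f (haar 0 I))) summable_on dyadic"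
  obtains g where "is_paraproduct 1 0 d f g"
proof -
  let ?c = "\<lambda>I. d I * pairing f (haar 0 I)"
  let ?S = "\<lambda>F x. \<Sum>I\<in>F. ?c I * haar 1 I x"
  have meas: "(\<lambda>x. ?c I * haar 1 I x) \<in> borel_measurable lborel" if "I \<in> dyadic" for I
    using that by (intro L2_measurable L2_scale haar_L2)
  have bd: "(\<integral>\<^sup>+x. ennreal (cmod (?S F x) ^ 1) \<partial>lborel) \<le> ennreal (\<Sum>I\<in>F. cmod (?c I))"
    if F: "finite F" "F \<subseteq> dyadic" for F
  proof -
    have "(\<integral>\<^sup>+x. ennreal (cmod (?S F x) ^ 1) \<partial>lborel)
        \<le> (\<integral>\<^sup>+x. (\<Sum>I\<in>F. ennreal (cmod (?c I)) * ennreal (cmod (haar 1 I x))) \<partial>lborel)"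
    proof (rule nn_integral_mono)
      fix x
      have "cmod (?S F x) \<le> (\<Sum>I\<in>F. cmod (?c I) * cmod (haar 1 I x))"
        by (rule order_trans[OF norm_sum]) (simp add: norm_mult)
      hence "ennreal (cmod (?S F x) ^ 1) \<le> ennreal (\<Sum>I\<in>F. cmod (?c I) * cmod (haar 1 I x))"
        by (intro ennreal_leI) simp
      also have "\<dots> = (\<Sum>I\<in>F. ennreal (cmod (?c I)) * ennreal (cmod (haar 1 I x)))"
        by (subst sum_ennreal[symmetric]) (auto simp: ennreal_mult intro!: sum.cong)
      finally show "ennreal (cmod (?S F x) ^ 1) \<le> (\<Sum>I\<in>F. ennreal (cmod (?c I)) * ennreal (cmod (haar 1 I x)))" .
    qed
    also have "\<dots> = (\<Sum>I\<in>F. ennreal (cmod (?c I)) * (\<integral>\<^sup>+x. ennreal (cmod (haar 1 I x)) \<partial>lborel))"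
    proof -
      have m: "(\<lambda>x. ennreal (cmod (haar 1 I x))) \<in> borel_measurable lborel" if "I \<in> F" for I
        using haar_measurable[of I 1] that F by auto
      show ?thesis
      proof (subst nn_integral_sum)
        show "(\<lambda>x. ennreal (cmod (?c I)) * ennreal (cmod (haar 1 I x))) \<in> borel_measurable lborel"
          if "I \<in> F" for I
          using m[OF that] by (intro borel_measurable_times_ennreal) simp_all
      qed (intro sum.cong refl nn_integral_cmult m)
    qed
    also have "\<dots> = (\<Sum>I\<in>F. ennreal (cmod (?c I)))"
      using F by (intro sum.cong) (auto simp: nn_integral_haar1[unfolded One_nat_def] subset_iff)
    also have "\<dots> = ennreal (\<Sum>I\<in>F. cmod (?c I))" by (rule sum_ennreal) simp
    finally show ?thesis .
  qed
  obtain g where g [measurable]: "g \<in> borel_measurable lborel"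
    and lim: "\<And>F. finite F \<Longrightarrow> F \<subseteq> dyadic \<Longrightarrow>
       (\<integral>\<^sup>+x. ennreal (cmod (g x - ?S F x) ^ 1) \<partial>lborel)
         \<le> ennreal (2 * ((\<Sum>\<^sub>\<infinity>I\<in>dyadic. cmod (?c I)) - (\<Sum>I\<in>F. cmod (?c I))))"
    using unconditional_sum_exists[where p = 1 and e = "\<lambda>I x. ?c I * haar 1 I x" and A = dyadic
          and w = "\<lambda>I. cmod (?c I)" and M = lborel, OF disjI1[OF refl] meas w norm_ge_zero bd] by blast
  have "(\<integral>\<^sup>+x. ennreal (cmod (g x)) \<partial>lborel) < \<infinity>"
    using lim[of "{}"] by (auto simp: le_less_trans)
  hence gi: "integrable lborel g" by (intro integrableI_bounded) auto
  hence gl: "locally_integrable g"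
    unfolding locally_integrable_def set_integrable_def
    by (auto intro!: integrable_real_mult_indicator integrable_mult_indicator)
  have "((\<lambda>F. LINT x:{r..s}|lborel. cmod (g x - ?S F x)) \<longlongrightarrow> 0) (finite_subsets_at_top dyadic)" for r s
  proof -
    have "((\<lambda>F. 2 * ((\<Sum>\<^sub>\<infinity>I\<in>dyadic. cmod (?c I)) - (\<Sum>I\<in>F. cmod (?c I)))) \<longlongrightarrow>
        2 * ((\<Sum>\<^sub>\<infinity>I\<in>dyadic. cmod (?c I)) - (\<Sum>\<^sub>\<infinity>I\<in>dyadic. cmod (?c I)))) (finite_subsets_at_top dyadic)"
      by (intro tendsto_intros infsum_tendsto w)
    hence z: "((\<lambda>F. 2 * ((\<Sum>\<^sub>\<infinity>I\<in>dyadic. cmod (?c I)) - (\<Sum>I\<in>F. cmod (?c I)))) \<longlongrightarrow> 0) (finite_subsets_at_top dyadic)"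
      by simp
    have le: "\<forall>\<^sub>F F in finite_subsets_at_top dyadic. (LINT x:{r..s}|lborel. cmod (g x - ?S F x))
       \<le> 2 * ((\<Sum>\<^sub>\<infinity>I\<in>dyadic. cmod (?c I)) - (\<Sum>I\<in>F. cmod (?c I)))"
    proof (rule eventually_finite_subsets_at_top_weakI)
      fix F :: "real set set" assume F: "finite F" "F \<subseteq> dyadic"
      have m: "(\<lambda>x. g x - ?S F x) \<in> borel_measurable lborel"
        using F by (intro borel_measurable_diff g L2_measurable L2_sum L2_scale haar_L2) auto
      have fin: "(\<integral>\<^sup>+x. ennreal (cmod (g x - ?S F x)) \<partial>lborel) < \<infinity>"
        using lim[OF F] by (auto simp: le_less_trans)
      have int: "integrable lborel (\<lambda>x. g x - ?S F x)"
        by (rule integrableI_bounded[OF m fin])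
      have "(LINT x:{r..s}|lborel. cmod (g x - ?S F x)) \<le> (LINT x|lborel. cmod (g x - ?S F x))"
        unfolding set_lebesgue_integral_def
        by (intro integral_mono integrable_mult_indicator integrable_norm int)
           (auto simp: indicator_def)
      also have "ennreal \<dots> = (\<integral>\<^sup>+x. ennreal (cmod (g x - ?S F x)) \<partial>lborel)"
        by (rule nn_integral_eq_integral[symmetric, OF integrable_norm[OF int]]) simp
      hence "(LINT x|lborel. cmod (g x - ?S F x)) \<le> 2 * ((\<Sum>\<^sub>\<infinity>I\<in>dyadic. cmod (?c I)) - (\<Sum>I\<in>F. cmod (?c I)))"
      proof -
        have "(\<Sum>I\<in>F. cmod (?c I)) \<le> (\<Sum>\<^sub>\<infinity>I\<in>dyadic. cmod (?c I))"
          using F by (intro finite_sum_le_infsum w) auto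
        moreover have "ennreal (LINT x|lborel. cmod (g x - ?S F x))
            \<le> ennreal (2 * ((\<Sum>\<^sub>\<infinity>I\<in>dyadic. cmod (?c I)) - (\<Sum>I\<in>F. cmod (?c I))))"
          using lim[OF F] \<open>ennreal _ = _\<close> by simp
        ultimately show ?thesis by (subst (asm) ennreal_le_iff) auto
      qed
      finally show "(LINT x:{r..s}|lborel. cmod (g x - ?S F x))
         \<le> 2 * ((\<Sum>\<^sub>\<infinity>I\<in>dyadic. cmod (?c I)) - (\<Sum>I\<in>F. cmod (?c I)))" .
    qed
    show ?thesis
      by (rule tendsto_sandwich[OF _ le tendsto_const z])
         (auto simp: set_lebesgue_integral_def intro!: always_eventually integral_nonneg_AE)
  qed
  hence "is_paraproduct 1 0 d f g"
    using gl by (simp add: is_paraproduct_def)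
  thus thesis by (rule that)
qed

section \<open>The bilinear form and the Hardy inequality on the dyadic tree\<close>

text \<open>The absorption step: a quantity controlled by its own square root can be divided by it,
  since it is a real number and hence finite. This is one reason to work with finite sets of
  intervals.\<close>

lemma le_square_of_le_mult_sqrt:
  fixes B S :: real
  assumes "0 \<le> S" "0 \<le> B" "S \<le> B * sqrt S"
  shows "S \<le> B\<^sup>2"
proof (cases "S = 0")
  case False
  hence "0 < sqrt S" using assms by simp
  moreover have "sqrt S * sqrt S \<le> B * sqrt S" using assms by simp
  ultimately have "sqrt S \<le> B" by (rule mult_right_le_imp_le[rotated])
  thus ?thesis by (rule sqrt_le_D)
qed simp

text \<open>The sets of \<open>G\<close> containing \<open>J\<close> form a chain, so each pair in
  the expanded square is comparable and can be grouped at its smaller member. One inner sum is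
  strict because the diagonal must be counted once. The factors attached to \<open>K\<close> do not
  depend on \<open>J\<close>, so the square is again a sum over the ancestors of
  \<open>J\<close>.\<close>

lemma chain_square_sum:
  fixes a :: "'a set \<Rightarrow> real"
  assumes G: "finite G" and chain: "\<And>K L. K \<in> G \<Longrightarrow> L \<in> G \<Longrightarrow> J \<subseteq> K \<Longrightarrow> J \<subseteq> L \<Longrightarrow> K \<subseteq> L \<or> L \<subseteq> K"
  shows "(\<Sum>K\<in>G. if J \<subseteq> K then a K else 0)\<^sup>2
       = (\<Sum>K\<in>G. if J \<subseteq> K then a K * ((\<Sum>L\<in>G. if K \<subseteq> L then a L else 0) + (\<Sum>L\<in>G. if K \<subset> L then a L else 0)) else 0)"
proof -
  define c where "c K = (if J \<subseteq> K then a K else 0)" for K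
  have "(\<Sum>K\<in>G. if J \<subseteq> K then a K * ((\<Sum>L\<in>G. if K \<subseteq> L then a L else 0) + (\<Sum>L\<in>G. if K \<subset> L then a L else 0)) else 0)
      = (\<Sum>K\<in>G. \<Sum>L\<in>G. c K * c L * of_bool (K \<subseteq> L)) + (\<Sum>K\<in>G. \<Sum>L\<in>G. c K * c L * of_bool (K \<subset> L))"
    unfolding sum.distrib[symmetric]
  proof (intro sum.cong refl)
    fix K assume "K \<in> G"
    have "a K * (if K \<subseteq> L then a L else 0) + a K * (if K \<subset> L then a L else 0)
        = c K * c L * of_bool (K \<subseteq> L) + c K * c L * of_bool (K \<subset> L)" if "J \<subseteq> K" for L
    proof (cases "K \<subseteq> L")
      case True
      with that have "J \<subseteq> L" by (rule order_trans)
      with that True show ?thesis by (simp add: c_def)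
    next
      case False
      thus ?thesis by (simp add: psubset_eq)
    qed
    moreover have "c K = 0" if "\<not> J \<subseteq> K" using that by (simp add: c_def)
    ultimately show "(if J \<subseteq> K then a K * (\<Sum>L\<in>G. (if K \<subseteq> L then a L else 0) + (if K \<subset> L then a L else 0)) else 0)
        = (\<Sum>L\<in>G. c K * c L * of_bool (K \<subseteq> L) + c K * c L * of_bool (K \<subset> L))"
      by (cases "J \<subseteq> K") (simp_all add: sum_distrib_left distrib_left)
  qed
  \<comment> \<open>Exchanging the indices reverses the strict inclusion. Along a chain,
    \<open>K \<subseteq> L\<close> and \<open>L \<subset> K\<close> are then complementary, and
    together they cover each ordered pair exactly once.\<close>
  also have "(\<Sum>K\<in>G. \<Sum>L\<in>G. c K * c L * of_bool (K \<subset> L)) = (\<Sum>K\<in>G. \<Sum>L\<in>G. c K * c L * of_bool (L \<subset> K))"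
    by (subst sum.swap) (simp add: mult_ac)
  also have "(\<Sum>K\<in>G. \<Sum>L\<in>G. c K * c L * of_bool (K \<subseteq> L)) + (\<Sum>K\<in>G. \<Sum>L\<in>G. c K * c L * of_bool (L \<subset> K))
      = (\<Sum>K\<in>G. \<Sum>L\<in>G. c K * c L)"
    unfolding sum.distrib[symmetric]
  proof (intro sum.cong refl)
    fix K L assume "K \<in> G" "L \<in> G"
    with chain[of K L] show "c K * c L * of_bool (K \<subseteq> L) + c K * c L * of_bool (L \<subset> K) = c K * c L"
      by (auto simp: c_def psubset_eq)
  qed
  also have "\<dots> = (\<Sum>K\<in>G. c K)\<^sup>2"
    by (simp add: power2_eq_square sum_product)
  finally show ?thesis by (simp add: c_def)
qed

text \<open>The square of the potential \<open>\<Phi>\<close> is itself a potential, with nonnegative increments \<open>\<delta>\<close>. Hence the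
  testing condition, which is the desired Carleson embedding for indicators of cones, applies to \<open>\<Phi>\<^sup>2\<close> by
  superposition, and Cauchy--Schwarz closes the estimate.\<close>

lemma tree_Hardy_inequality:
  fixes \<beta> y m M :: "real set \<Rightarrow> real"
  assumes G: "finite G" "G \<subseteq> dyadic"
    and nonneg: "\<And>J. 0 \<le> \<beta> J" "\<And>J. 0 \<le> y J" "\<And>J. 0 \<le> m J" "\<And>J. 0 \<le> M J"
    and mass: "\<And>K. K \<in> G \<Longrightarrow> (\<Sum>I\<in>G. if I \<subseteq> K then m I else 0) \<le> M K"
    and testing: "\<And>K. K \<in> G \<Longrightarrow> (\<Sum>J\<in>G. if J \<subseteq> K then (\<beta> J * M J)\<^sup>2 else 0) \<le> C\<^sup>2 * M K"
  shows "(\<Sum>I\<in>G. m I * (\<Sum>J\<in>G. if I \<subseteq> J then \<beta> J * y J else 0)\<^sup>2) \<le> 4 * C\<^sup>2 * (\<Sum>J\<in>G. (y J)\<^sup>2)"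
proof -
  define a where "a J = \<beta> J * y J" for J
  define \<Phi> where "\<Phi> J = (\<Sum>K\<in>G. if J \<subseteq> K then a K else 0)" for J
  define \<delta> where "\<delta> K = a K * (\<Phi> K + (\<Sum>L\<in>G. if K \<subset> L then a L else 0))" for K
  have a: "0 \<le> a J" for J using nonneg by (simp add: a_def)
  have \<Phi>: "0 \<le> \<Phi> J" for J unfolding \<Phi>_def using a by (intro sum_nonneg) auto
  have \<delta>: "0 \<le> \<delta> K" for K
    unfolding \<delta>_def using a \<Phi> by (intro mult_nonneg_nonneg add_nonneg_nonneg sum_nonneg) auto
  \<comment> \<open>The discrete form of d(\<Phi>^2) = 2 \<Phi> d\<Phi>. Squared in the last step,
    this 2 becomes the 4 of the conclusion.\<close>
  have \<delta>_le: "\<delta> K \<le> 2 * (a K * \<Phi> K)" for K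
  proof -
    have "(\<Sum>L\<in>G. if K \<subset> L then a L else 0) \<le> \<Phi> K"
      unfolding \<Phi>_def using a by (intro sum_mono) auto
    hence "\<delta> K \<le> a K * (\<Phi> K + \<Phi> K)"
      unfolding \<delta>_def using a by (intro mult_left_mono add_left_mono)
    thus ?thesis by simp
  qed
  have sq: "(\<Phi> J)\<^sup>2 = (\<Sum>K\<in>G. if J \<subseteq> K then \<delta> K else 0)" if "J \<in> G" for J
    unfolding \<delta>_def \<Phi>_def
  proof (rule chain_square_sum[OF G(1)])
    fix K L assume KL: "K \<in> G" "L \<in> G" "J \<subseteq> K" "J \<subseteq> L"
    have "J \<noteq> {}" using that G dyadic_nonempty by auto
    thus "K \<subseteq> L \<or> L \<subseteq> K" using KL dyadic_nested[of K L] G by auto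
  qed
  \<comment> \<open>Left general in \<open>n\<close> because it is used twice: with
    \<open>n = m\<close> for the sum to be estimated, and with the testing weights (\<beta> M)^2.
    Both are thereby compared with the one quantity \<open>Y\<close>.\<close>
  have superpose: "(\<Sum>I\<in>G. n I * (\<Phi> I)\<^sup>2) = (\<Sum>K\<in>G. \<delta> K * (\<Sum>I\<in>G. if I \<subseteq> K then n I else 0))" for n
  proof -
    have "(\<Sum>I\<in>G. n I * (\<Phi> I)\<^sup>2) = (\<Sum>I\<in>G. \<Sum>K\<in>G. \<delta> K * (if I \<subseteq> K then n I else 0))"
      by (intro sum.cong refl) (auto simp: sq sum_distrib_left intro!: sum.cong)
    also have "\<dots> = (\<Sum>K\<in>G. \<delta> K * (\<Sum>I\<in>G. if I \<subseteq> K then n I else 0))"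
      by (subst sum.swap) (simp add: sum_distrib_left)
    finally show ?thesis .
  qed
  define Y where "Y = (\<Sum>K\<in>G. \<delta> K * M K)"
  have Y: "0 \<le> Y" unfolding Y_def using \<delta> nonneg by (intro sum_nonneg) auto
  have X: "(\<Sum>I\<in>G. m I * (\<Phi> I)\<^sup>2) \<le> Y"
    unfolding superpose Y_def by (intro sum_mono mult_left_mono mass \<delta>)
  have "(\<Sum>J\<in>G. (\<beta> J * M J)\<^sup>2 * (\<Phi> J)\<^sup>2) \<le> (\<Sum>K\<in>G. \<delta> K * (C\<^sup>2 * M K))"
    unfolding superpose by (intro sum_mono mult_left_mono testing \<delta>)
  also have "\<dots> = C\<^sup>2 * Y" by (simp add: Y_def sum_distrib_left mult_ac)
  finally have Z: "(\<Sum>J\<in>G. (\<beta> J * M J * \<Phi> J)\<^sup>2) \<le> C\<^sup>2 * Y" by (simp add: power_mult_distrib)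
  \<comment> \<open>Writing \<open>a = \<beta> y\<close> separates \<open>y\<close> from \<beta> M
    \<Phi>, whose square sum is already at most C^2 Y. Cauchy--Schwarz therefore bounds
    \<open>Y\<close> by a multiple of its own square root.\<close>
  have "Y \<le> (\<Sum>K\<in>G. 2 * (a K * \<Phi> K) * M K)"
    unfolding Y_def by (intro sum_mono mult_right_mono \<delta>_le nonneg)
  also have "\<dots> = 2 * (\<Sum>K\<in>G. \<bar>y K\<bar> * \<bar>\<beta> K * M K * \<Phi> K\<bar>)"
    using nonneg \<Phi> by (simp add: a_def sum_distrib_left mult_ac abs_mult)
  also have "\<dots> \<le> 2 * (L2_set y G * L2_set (\<lambda>K. \<beta> K * M K * \<Phi> K) G)"
    by (intro mult_left_mono L2_set_mult_ineq) simp
  also have "\<dots> \<le> 2 * (L2_set y G * sqrt (C\<^sup>2 * Y))"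
    unfolding L2_set_def[of "\<lambda>K. \<beta> K * M K * \<Phi> K"] by (intro mult_left_mono real_sqrt_le_mono Z) auto
  also have "\<dots> = 2 * \<bar>C\<bar> * L2_set y G * sqrt Y" by (simp add: real_sqrt_mult)
  finally have "Y \<le> (2 * \<bar>C\<bar> * L2_set y G)\<^sup>2"
    by (intro le_square_of_le_mult_sqrt Y) auto
  also have "\<dots> = 4 * C\<^sup>2 * (\<Sum>J\<in>G. (y J)\<^sup>2)"
    by (simp add: power_mult_distrib L2_set_def sum_nonneg)
  finally have "Y \<le> 4 * C\<^sup>2 * (\<Sum>J\<in>G. (y J)\<^sup>2)" .
  with X have "(\<Sum>I\<in>G. m I * (\<Phi> I)\<^sup>2) \<le> 4 * C\<^sup>2 * (\<Sum>J\<in>G. (y J)\<^sup>2)"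
    by (rule order_trans)
  thus ?thesis unfolding \<Phi>_def a_def .
qed

section \<open>Bounded forms, row sums and sum testing\<close>

definition overlap :: "real set \<Rightarrow> real set \<Rightarrow> real" where
  "overlap I J = measure lborel (I \<inter> J) / (len I * len J)"

lemma overlap_commute: "overlap I J = overlap J I"
  by (simp add: overlap_def Int_commute mult.commute)

lemma overlap_nonneg [simp]: "0 \<le> overlap I J"
  by (simp add: overlap_def)

lemma overlap_subset:
  assumes "I \<in> dyadic" "I \<subseteq> J"
  shows "overlap I J = 1 / len J"
  using assms dyadic_len_pos[of I] by (simp add: overlap_def Int_absorb2)

lemma overlap_disjoint: "I \<inter> J = {} \<Longrightarrow> overlap I J = 0"
  by (simp add: overlap_def)

text \<open>Only an upper bound, because for \<open>I = J\<close> both terms on the right are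
  present.\<close>

lemma overlap_le_split:
  assumes "I \<in> dyadic" "J \<in> dyadic"
  shows "overlap I J \<le> (if I \<subseteq> J then 1 / len J else 0) + (if J \<subseteq> I then 1 / len I else 0)"
  using dyadic_nested[OF assms] overlap_subset[of I J] overlap_subset[of J I] assms
  by (auto simp: overlap_disjoint overlap_commute[of J I])

text \<open>Boundedness of the nonnegative bilinear form on sequences to which the composition reduces after
  passing to Haar coefficients and removing the phases of the symbols; it is symmetric in \<open>b\<close> and \<open>d\<close>.\<close>

definition form_bounded :: "(real set \<Rightarrow> complex) \<Rightarrow> (real set \<Rightarrow> complex) \<Rightarrow> real \<Rightarrow> bool" where
  "form_bounded b d C \<longleftrightarrow> (\<forall>G x y. finite G \<longrightarrow> G \<subseteq> dyadic \<longrightarrow> (\<forall>I. 0 \<le> x I) \<longrightarrow> (\<forall>J. 0 \<le> y J) \<longrightarrow>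
     (\<Sum>J\<in>G. \<Sum>I\<in>G. cmod (b J) * cmod (d I) * overlap I J * x I * y J) \<le> C * L2_set x G * L2_set y G)"

lemma form_boundedD:
  "form_bounded b d C \<Longrightarrow> finite G \<Longrightarrow> G \<subseteq> dyadic \<Longrightarrow> (\<And>I. 0 \<le> x I) \<Longrightarrow> (\<And>J. 0 \<le> y J) \<Longrightarrow>
     (\<Sum>J\<in>G. \<Sum>I\<in>G. cmod (b J) * cmod (d I) * overlap I J * x I * y J) \<le> C * L2_set x G * L2_set y G"
  by (simp add: form_bounded_def)

lemma form_bounded_commute:
  assumes "form_bounded b d C"
  shows "form_bounded d b C"
  unfolding form_bounded_def
proof (intro allI impI)
  fix G :: "real set set" and x y :: "real set \<Rightarrow> real"
  assume *: "finite G" "G \<subseteq> dyadic" "\<forall>I. 0 \<le> x I" "\<forall>J. 0 \<le> y J"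
  have "(\<Sum>J\<in>G. \<Sum>I\<in>G. cmod (d J) * cmod (b I) * overlap I J * x I * y J)
      = (\<Sum>J\<in>G. \<Sum>I\<in>G. cmod (b J) * cmod (d I) * overlap I J * y I * x J)"
    by (subst sum.swap) (simp add: overlap_commute mult_ac)
  also have "\<dots> \<le> C * L2_set y G * L2_set x G"
    using * by (intro form_boundedD[OF assms]) auto
  finally show "(\<Sum>J\<in>G. \<Sum>I\<in>G. cmod (d J) * cmod (b I) * overlap I J * x I * y J)
      \<le> C * L2_set x G * L2_set y G" by (simp add: mult_ac)
qed

text \<open>Duality: the form is tested against the row sums themselves, and the resulting square
  root is absorbed. Since the form uses one index set for both arguments, \<open>x\<close> and the
  row sums are extended by zero from \<open>F\<close> and \<open>G\<close> to the union.\<close>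

lemma form_bounded_row_sums:
  assumes fb: "form_bounded b d C" and C: "0 \<le> C"
    and F: "finite F" "F \<subseteq> dyadic" and G: "finite G" "G \<subseteq> dyadic" and x: "\<And>I. 0 \<le> x I"
  shows "(\<Sum>J\<in>G. (\<Sum>I\<in>F. cmod (b J) * cmod (d I) * overlap I J * x I)\<^sup>2) \<le> C\<^sup>2 * (\<Sum>I\<in>F. (x I)\<^sup>2)"
proof -
  define z where "z I = (if I \<in> F then x I else 0)" for I
  define r where "r J = (\<Sum>I\<in>F. cmod (b J) * cmod (d I) * overlap I J * x I)" for J
  define q where "q J = (if J \<in> G then r J else 0)" for J
  let ?H = "F \<union> G"
  have r: "0 \<le> r J" for J unfolding r_def using x by (intro sum_nonneg) auto
  have inner: "(\<Sum>I\<in>?H. cmod (b J) * cmod (d I) * overlap I J * z I) = r J" for J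
    unfolding r_def using F G by (intro sum.mono_neutral_cong_right) (auto simp: z_def)
  have zs: "(\<Sum>I\<in>?H. (z I)\<^sup>2) = (\<Sum>I\<in>F. (x I)\<^sup>2)"
    using F G by (intro sum.mono_neutral_cong_right) (auto simp: z_def)
  have qs: "(\<Sum>J\<in>?H. (q J)\<^sup>2) = (\<Sum>J\<in>G. (r J)\<^sup>2)"
    using F G by (intro sum.mono_neutral_cong_right) (auto simp: q_def)
  define S where "S = (\<Sum>J\<in>G. (r J)\<^sup>2)"
  have S: "0 \<le> S" unfolding S_def by (intro sum_nonneg) auto
  have "S = (\<Sum>J\<in>?H. r J * q J)"
    unfolding S_def using F G
    by (intro sum.mono_neutral_cong_left) (auto simp: q_def power2_eq_square)
  also have "\<dots> = (\<Sum>J\<in>?H. \<Sum>I\<in>?H. cmod (b J) * cmod (d I) * overlap I J * z I * q J)"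
    by (simp only: inner[symmetric] sum_distrib_right)
  also have "\<dots> \<le> C * L2_set z ?H * L2_set q ?H"
    using F G x r by (intro form_boundedD[OF fb]) (auto simp: z_def q_def)
  also have "\<dots> = C * sqrt (\<Sum>I\<in>F. (x I)\<^sup>2) * sqrt S"
    by (simp add: L2_set_def zs qs S_def)
  finally have "S \<le> (C * sqrt (\<Sum>I\<in>F. (x I)\<^sup>2))\<^sup>2"
    by (intro le_square_of_le_mult_sqrt S) (use C in \<open>auto simp: sum_nonneg\<close>)
  thus ?thesis by (simp add: S_def r_def power_mult_distrib sum_nonneg)
qed

text \<open>The Haar coefficient at \<open>J\<close> of the composition, applied to a function with
  Haar coefficients \<open>f\<close>. The factor \<open>b J\<close> stays inside the sum because
  boundedness of the form controls only the weighted terms: where \<open>b J = 0\<close>, the bare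
  series may diverge.\<close>

definition row_sum ::
  "(real set \<Rightarrow> complex) \<Rightarrow> (real set \<Rightarrow> complex) \<Rightarrow> (real set \<Rightarrow> complex) \<Rightarrow> real set \<Rightarrow> complex" where
  "row_sum b d f J = (\<Sum>\<^sub>\<infinity>I\<in>dyadic. b J * (d I * f I * of_real (overlap I J)))"

context
  fixes b d f :: "real set \<Rightarrow> complex" and C :: real
  assumes fb: "form_bounded b d C" and C: "0 \<le> C"
    and f: "(\<lambda>I. (cmod (f I))\<^sup>2) summable_on dyadic"
begin

text \<open>The moduli are inside and the bound depends on neither \<open>F\<close> nor
  \<open>G\<close>. With \<open>G\<close> a single interval it gives absolute convergence of a row;
  with \<open>G\<close> fixed and \<open>F\<close> growing it gives the bound for the full row
  sums.\<close>

lemma form_bounded_partial_rows: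
  assumes F: "finite F" "F \<subseteq> dyadic" and G: "finite G" "G \<subseteq> dyadic"
  shows "(\<Sum>J\<in>G. (\<Sum>I\<in>F. cmod (b J * (d I * f I * of_real (overlap I J))))\<^sup>2)
    \<le> C\<^sup>2 * (\<Sum>\<^sub>\<infinity>I\<in>dyadic. (cmod (f I))\<^sup>2)"
proof -
  have "(\<Sum>J\<in>G. (\<Sum>I\<in>F. cmod (b J * (d I * f I * of_real (overlap I J))))\<^sup>2)
      = (\<Sum>J\<in>G. (\<Sum>I\<in>F. cmod (b J) * cmod (d I) * overlap I J * cmod (f I))\<^sup>2)"
    by (simp add: norm_mult mult_ac)
  also have "\<dots> \<le> C\<^sup>2 * (\<Sum>I\<in>F. (cmod (f I))\<^sup>2)"
    by (rule form_bounded_row_sums[OF fb C F G]) simp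
  also have "\<dots> \<le> C\<^sup>2 * (\<Sum>\<^sub>\<infinity>I\<in>dyadic. (cmod (f I))\<^sup>2)"
    by (intro mult_left_mono finite_sum_le_infsum f F) auto
  finally show ?thesis .
qed

lemma row_summable:
  assumes J: "J \<in> dyadic"
  shows "(\<lambda>I. b J * (d I * f I * of_real (overlap I J))) summable_on dyadic"
proof -
  let ?S = "C\<^sup>2 * (\<Sum>\<^sub>\<infinity>I\<in>dyadic. (cmod (f I))\<^sup>2)"
  have "(\<Sum>I\<in>F. cmod (b J * (d I * f I * of_real (overlap I J)))) \<le> sqrt ?S"
    if "finite F" "F \<subseteq> dyadic" for F
    using form_bounded_partial_rows[OF that, of "{J}"] J by (intro real_le_rsqrt) simp
  hence "(\<lambda>I. cmod (b J * (d I * f I * of_real (overlap I J)))) summable_on dyadic"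
    by (intro nonneg_bdd_above_summable_on bdd_aboveI2[where M = "sqrt ?S"]) auto
  thus ?thesis by (rule abs_summable_summable)
qed

lemma row_sum_finite_le:
  assumes G: "finite G" "G \<subseteq> dyadic"
  shows "(\<Sum>J\<in>G. (cmod (row_sum b d f J))\<^sup>2) \<le> C\<^sup>2 * (\<Sum>\<^sub>\<infinity>I\<in>dyadic. (cmod (f I))\<^sup>2)"
proof (rule tendsto_upperbound)
  show "((\<lambda>F. \<Sum>J\<in>G. (cmod (\<Sum>I\<in>F. b J * (d I * f I * of_real (overlap I J))))\<^sup>2)
      \<longlongrightarrow> (\<Sum>J\<in>G. (cmod (row_sum b d f J))\<^sup>2)) (finite_subsets_at_top dyadic)"
    unfolding row_sum_def using G by (intro tendsto_intros infsum_tendsto row_summable) auto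
  show "\<forall>\<^sub>F F in finite_subsets_at_top dyadic.
      (\<Sum>J\<in>G. (cmod (\<Sum>I\<in>F. b J * (d I * f I * of_real (overlap I J))))\<^sup>2)
        \<le> C\<^sup>2 * (\<Sum>\<^sub>\<infinity>I\<in>dyadic. (cmod (f I))\<^sup>2)"
  proof (rule eventually_finite_subsets_at_top_weakI)
    fix F :: "real set set" assume F: "finite F" "F \<subseteq> dyadic"
    have "(\<Sum>J\<in>G. (cmod (\<Sum>I\<in>F. b J * (d I * f I * of_real (overlap I J))))\<^sup>2)
        \<le> (\<Sum>J\<in>G. (\<Sum>I\<in>F. cmod (b J * (d I * f I * of_real (overlap I J))))\<^sup>2)"
      by (intro sum_mono power_mono norm_sum) auto
    also have "\<dots> \<le> C\<^sup>2 * (\<Sum>\<^sub>\<infinity>I\<in>dyadic. (cmod (f I))\<^sup>2)"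
      by (rule form_bounded_partial_rows[OF F G])
    finally show "(\<Sum>J\<in>G. (cmod (\<Sum>I\<in>F. b J * (d I * f I * of_real (overlap I J))))\<^sup>2)
        \<le> C\<^sup>2 * (\<Sum>\<^sub>\<infinity>I\<in>dyadic. (cmod (f I))\<^sup>2)" .
  qed
qed simp

lemma row_sum_square_summable: "(\<lambda>J. (cmod (row_sum b d f J))\<^sup>2) summable_on dyadic"
  using row_sum_finite_le
  by (intro nonneg_bdd_above_summable_on
        bdd_aboveI2[where M = "C\<^sup>2 * (\<Sum>\<^sub>\<infinity>I\<in>dyadic. (cmod (f I))\<^sup>2)"]) auto

lemma row_sum_infsum_le:
  "(\<Sum>\<^sub>\<infinity>J\<in>dyadic. (cmod (row_sum b d f J))\<^sup>2) \<le> C\<^sup>2 * (\<Sum>\<^sub>\<infinity>I\<in>dyadic. (cmod (f I))\<^sup>2)"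
  by (intro infsum_le_finite_sums row_sum_square_summable row_sum_finite_le)

end

text \<open>The tree inequality with masses |d_I|^2 and \<beta>_J = |b_J| / |J|. Its
  \<open>M J\<close> is the full mass of all dyadic intervals below \<open>J\<close>, as in the
  testing condition, whereas \<open>G\<close> sees only finitely many; hence the masses there are
  merely dominated by \<open>M\<close>. The vector \<open>v\<close> is the half form applied to
  \<open>y\<close>, and Cauchy--Schwarz pairs it with \<open>x\<close>.\<close>

lemma sum_testing_half_form:
  assumes st: "sum_testing b d C" and d: "locally_square_summable d"
    and G: "finite G" "G \<subseteq> dyadic" and x: "\<And>I. 0 \<le> x I" and y: "\<And>I. 0 \<le> y I"
  shows "(\<Sum>J\<in>G. \<Sum>I\<in>G. cmod (b J) * cmod (d I) * (if I \<subseteq> J then 1 / len J else 0) * x I * y J)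
      \<le> 2 * \<bar>C\<bar> * L2_set x G * L2_set y G"
proof -
  define M where "M J = (\<Sum>\<^sub>\<infinity>L\<in>dyadic_below J. (cmod (d L))\<^sup>2)" for J
  define \<beta> where "\<beta> J = cmod (b J) / len J" for J
  define v where "v I = cmod (d I) * (\<Sum>J\<in>G. if I \<subseteq> J then \<beta> J * y J else 0)" for I
  have dsum: "(\<lambda>L. (cmod (d L))\<^sup>2) summable_on dyadic_below K" if "K \<in> G" for K
    using d that G by (auto simp: locally_square_summable_def)
  have filter: "(\<Sum>I\<in>G. if I \<subseteq> K then n I else 0) = (\<Sum>I\<in>{I \<in> G. I \<subseteq> K}. n I)" for K and n :: "real set \<Rightarrow> real"
    using G(1) by (rule sum.inter_filter[symmetric])
  have mass: "(\<Sum>I\<in>G. if I \<subseteq> K then (cmod (d I))\<^sup>2 else 0) \<le> M K" if "K \<in> G" for K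
    unfolding filter M_def using G by (intro finite_sum_le_infsum dsum that) (auto simp: dyadic_below_def)
  have test: "(\<Sum>J\<in>G. if J \<subseteq> K then (\<beta> J * M J)\<^sup>2 else 0) \<le> C\<^sup>2 * M K" if "K \<in> G" for K
  proof -
    let ?t = "\<lambda>J. (cmod (b J))\<^sup>2 * (1 / (len J)\<^sup>2) * (M J)\<^sup>2"
    have K: "?t summable_on dyadic_below K" "infsum ?t (dyadic_below K) \<le> C\<^sup>2 * M K"
      using st that G by (auto simp: sum_testing_def M_def)
    have "(\<Sum>J\<in>G. if J \<subseteq> K then (\<beta> J * M J)\<^sup>2 else 0) = (\<Sum>J\<in>{J \<in> G. J \<subseteq> K}. ?t J)"
      unfolding filter by (simp add: \<beta>_def power_mult_distrib power_divide)
    also have "\<dots> \<le> infsum ?t (dyadic_below K)"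
      using G by (intro finite_sum_le_infsum K) (auto simp: dyadic_below_def)
    finally show ?thesis using K(2) by simp
  qed
  have "(\<Sum>I\<in>G. (v I)\<^sup>2) = (\<Sum>I\<in>G. (cmod (d I))\<^sup>2 * (\<Sum>J\<in>G. if I \<subseteq> J then \<beta> J * y J else 0)\<^sup>2)"
    by (simp add: v_def power_mult_distrib)
  also have "\<dots> \<le> 4 * C\<^sup>2 * (\<Sum>J\<in>G. (y J)\<^sup>2)"
    using y mass test by (intro tree_Hardy_inequality[OF G, of _ _ _ M]) (auto simp: \<beta>_def M_def intro!: infsum_nonneg)
  finally have "L2_set v G \<le> sqrt (4 * C\<^sup>2 * (\<Sum>J\<in>G. (y J)\<^sup>2))"
    unfolding L2_set_def by simp
  also have "\<dots> = 2 * \<bar>C\<bar> * L2_set y G"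
    by (simp add: L2_set_def real_sqrt_mult)
  finally have v: "L2_set v G \<le> 2 * \<bar>C\<bar> * L2_set y G" .
  have "(\<Sum>J\<in>G. \<Sum>I\<in>G. cmod (b J) * cmod (d I) * (if I \<subseteq> J then 1 / len J else 0) * x I * y J)
      = (\<Sum>I\<in>G. x I * v I)"
    unfolding v_def
    by (subst sum.swap, intro sum.cong refl) (auto simp: sum_distrib_left \<beta>_def mult_ac intro!: sum.cong)
  also have "\<dots> \<le> (\<Sum>I\<in>G. \<bar>x I\<bar> * \<bar>v I\<bar>)"
    by (intro sum_mono) (simp flip: abs_mult)
  also have "\<dots> \<le> L2_set x G * L2_set v G" by (rule L2_set_mult_ineq)
  also have "\<dots> \<le> L2_set x G * (2 * \<bar>C\<bar> * L2_set y G)"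
    by (intro mult_left_mono v) simp
  finally show ?thesis by (simp add: mult_ac)
qed

lemma sum_testing_imp_form_bounded:
  assumes b: "locally_square_summable b" and d: "locally_square_summable d"
    and "sum_testing b d C\<^sub>1" "sum_testing d b C\<^sub>2"
  shows "form_bounded b d (2 * (\<bar>C\<^sub>1\<bar> + \<bar>C\<^sub>2\<bar>))"
  unfolding form_bounded_def
proof (intro allI impI)
  fix G :: "real set set" and x y :: "real set \<Rightarrow> real"
  assume G: "finite G" "G \<subseteq> dyadic" and x: "\<forall>I. 0 \<le> x I" and y: "\<forall>J. 0 \<le> y J"
  let ?s = "\<lambda>I J. if I \<subseteq> J then 1 / len J else 0"
  have "(\<Sum>J\<in>G. \<Sum>I\<in>G. cmod (b J) * cmod (d I) * overlap I J * x I * y J)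
      \<le> (\<Sum>J\<in>G. \<Sum>I\<in>G. cmod (b J) * cmod (d I) * (?s I J + ?s J I) * x I * y J)"
    using G x y by (intro sum_mono mult_right_mono mult_left_mono overlap_le_split) auto
  also have "\<dots> = (\<Sum>J\<in>G. \<Sum>I\<in>G. cmod (b J) * cmod (d I) * ?s I J * x I * y J)
      + (\<Sum>J\<in>G. \<Sum>I\<in>G. cmod (b J) * cmod (d I) * ?s J I * x I * y J)"
    by (simp only: distrib_left distrib_right sum.distrib)
  \<comment> \<open>Renaming the indices turns the second half into the first with \<open>b\<close>
    and \<open>d\<close>, and \<open>x\<close> and \<open>y\<close>, exchanged, so that the other
    testing condition applies.\<close>
  also have "(\<Sum>J\<in>G. \<Sum>I\<in>G. cmod (b J) * cmod (d I) * ?s J I * x I * y J)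
      = (\<Sum>J\<in>G. \<Sum>I\<in>G. cmod (d J) * cmod (b I) * ?s I J * y I * x J)"
    by (subst sum.swap) (simp only: mult_ac)
  also have "(\<Sum>J\<in>G. \<Sum>I\<in>G. cmod (b J) * cmod (d I) * ?s I J * x I * y J)
      + (\<Sum>J\<in>G. \<Sum>I\<in>G. cmod (d J) * cmod (b I) * ?s I J * y I * x J)
      \<le> 2 * \<bar>C\<^sub>1\<bar> * L2_set x G * L2_set y G + 2 * \<bar>C\<^sub>2\<bar> * L2_set y G * L2_set x G"
    using assms G x y by (intro add_mono sum_testing_half_form) auto
  finally show "(\<Sum>J\<in>G. \<Sum>I\<in>G. cmod (b J) * cmod (d I) * overlap I J * x I * y J)
      \<le> 2 * (\<bar>C\<^sub>1\<bar> + \<bar>C\<^sub>2\<bar>) * L2_set x G * L2_set y G" by (simp add: algebra_simps)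
qed

section \<open>From the composition to the bilinear form\<close>

lemma Q_seq_has_L2_sum:
  assumes "(\<lambda>J. (cmod (a J))\<^sup>2) summable_on dyadic_below I"
  shows "has_L2_sum (\<lambda>J x. a J * haar 0 J x) (dyadic_below I) (Q_seq I a)"
proof -
  have "dyadic_below I \<subseteq> dyadic" by (auto simp: dyadic_below_def)
  from haar.Riesz_Fischer[OF assms this]
  have "\<exists>g. has_L2_sum (\<lambda>J x. a J * haar 0 J x) (dyadic_below I) g" by blast
  thus ?thesis unfolding Q_seq_def by (rule someI_ex)
qed

lemma Q_seq_L2_norm:
  assumes "(\<lambda>J. (cmod (a J))\<^sup>2) summable_on dyadic_below I"
  shows "(L2_norm (Q_seq I a))\<^sup>2 = (\<Sum>\<^sub>\<infinity>J\<in>dyadic_below I. (cmod (a J))\<^sup>2)"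
  using haar.has_L2_sum_norm[OF Q_seq_has_L2_sum[OF assms]]
  by (intro infsumI[symmetric]) (auto simp: dyadic_below_def)

lemma Q_seq_pairing:
  assumes "(\<lambda>J. (cmod (a J))\<^sup>2) summable_on dyadic_below I" "J \<in> dyadic"
  shows "pairing (Q_seq I a) (haar 0 J) = (if J \<in> dyadic_below I then a J else 0)"
  using haar.has_L2_sum_pairing[OF Q_seq_has_L2_sum[OF assms(1)] _ assms(2)]
  by (auto simp: dyadic_below_def)

lemma Q_fun_L2_norm:
  assumes "u \<in> L2"
  shows "(L2_norm (Q_fun I u))\<^sup>2 = (\<Sum>\<^sub>\<infinity>J\<in>dyadic_below I. (cmod (pairing u (haar 0 J)))\<^sup>2)"
  unfolding Q_fun_def
  by (intro Q_seq_L2_norm haar.Bessel_summable assms) (auto simp: dyadic_below_def)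

lemma averaging_paraproduct_pairing:
  assumes g: "is_paraproduct 1 0 d f g" and J: "J \<in> dyadic"
  shows "((\<lambda>I. b J * (d I * pairing f (haar 0 I) * of_real (overlap I J))) has_sum b J * pairing g (haar 1 J)) dyadic"
proof (rule has_sum_cmult_right)
  have "((\<lambda>I. d I * pairing f (haar 0 I) * pairing (haar 1 I) (haar 1 J)) has_sum pairing g (haar 1 J)) dyadic"
    by (rule paraproduct_pairing_haar[OF g J])
  thus "((\<lambda>I. d I * pairing f (haar 0 I) * of_real (overlap I J)) has_sum pairing g (haar 1 J)) dyadic"
    by (rule has_sum_cong[THEN iffD1, rotated]) (simp only: pairing_haar1 J overlap_def)
qed

text \<open>The coefficients of the output do not depend on which intermediate function realises the
  composition, since L1 convergence already fixes its averages over dyadic intervals.\<close>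

lemma composition_coefficient:
  assumes "is_composition b d f u" "J \<in> dyadic"
  shows "pairing u (haar 0 J) = row_sum b d (\<lambda>I. pairing f (haar 0 I)) J"
proof -
  obtain g where g: "is_paraproduct 1 0 d f g" "is_paraproduct 0 1 b g u"
    using assms(1) by (auto simp: is_composition_def)
  show ?thesis
    unfolding row_sum_def paraproduct_haar_coefficient[OF g(2) assms(2)]
    by (rule infsumI[symmetric, OF averaging_paraproduct_pairing[OF g(1) assms(2)]])
qed

lemma compositionI:
  assumes "(\<lambda>I. cmod (d I * pairing f (haar 0 I))) summable_on dyadic"
    and u: "has_L2_sum (\<lambda>J x. row_sum b d (\<lambda>I. pairing f (haar 0 I)) J * haar 0 J x) dyadic u"
  shows "is_composition b d f u"
proof -
  obtain g where g: "is_paraproduct 1 0 d f g"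
    using averaging_paraproduct_exists[OF assms(1)] .
  have "is_paraproduct 0 1 b g u"
    by (rule has_L2_sum_imp_paraproduct[OF u])
       (simp only: row_sum_def infsumI[OF averaging_paraproduct_pairing[OF g]])
  with g show ?thesis by (auto simp: is_composition_def)
qed

lemma form_bounded_imp_operator_testing:
  assumes fb: "form_bounded b d C" and C: "0 \<le> C" and d: "locally_square_summable d"
  shows "operator_testing b d C"
  unfolding operator_testing_def
proof
  fix I assume I: "I \<in> dyadic"
  let ?D = "dyadic_below I"
  have D: "?D \<subseteq> dyadic" by (auto simp: dyadic_below_def)
  have dI: "(\<lambda>L. (cmod (d L))\<^sup>2) summable_on ?D"
    using d I by (auto simp: locally_square_summable_def)
  hence dI': "(\<lambda>L. (cmod (cnj (d L)))\<^sup>2) summable_on ?D" by simp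
  define f where "f = Q_seq I (\<lambda>J. cnj (d J))"
  have fL: "f \<in> L2" unfolding f_def by (rule has_L2_sum_in_L2[OF Q_seq_has_L2_sum[OF dI']])
  have fp: "pairing f (haar 0 J) = (if J \<in> ?D then cnj (d J) else 0)" if "J \<in> dyadic" for J
    unfolding f_def by (rule Q_seq_pairing[OF dI' that])
  have fn: "(L2_norm f)\<^sup>2 = (L2_norm (Q_seq I d))\<^sup>2"
    unfolding f_def Q_seq_L2_norm[OF dI'] Q_seq_L2_norm[OF dI] by simp
  let ?p = "\<lambda>I. pairing f (haar 0 I)"
  note p = haar.Bessel_summable[OF fL order_refl]
  \<comment> \<open>Below \<open>I\<close> the product of the symbol with the coefficient of the
    test function has modulus |d_L|^2, and elsewhere it is 0. Local square summability is thus
    exactly what lets the inner factor act on the test function.\<close>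
  have "(\<lambda>I. cmod (d I * ?p I)) summable_on dyadic \<longleftrightarrow> (\<lambda>L. (cmod (d L))\<^sup>2) summable_on ?D"
    by (rule summable_on_cong_neutral) (use D in \<open>auto simp: fp norm_mult power2_eq_square\<close>)
  hence summ: "(\<lambda>I. cmod (d I * ?p I)) summable_on dyadic" using dI by simp
  note row = row_sum_square_summable[OF fb C p]
  obtain u where u: "has_L2_sum (\<lambda>J x. row_sum b d ?p J * haar 0 J x) dyadic u"
    using haar.Riesz_Fischer[OF row order_refl] .
  have comp: "is_composition b d f u" by (rule compositionI[OF summ u])
  note uL = has_L2_sum_in_L2[OF u]
  have "(L2_norm (Q_fun I u))\<^sup>2 = (\<Sum>\<^sub>\<infinity>J\<in>?D. (cmod (row_sum b d ?p J))\<^sup>2)"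
    unfolding Q_fun_L2_norm[OF uL] using composition_coefficient[OF comp] D
    by (intro infsum_cong) (simp add: subset_iff)
  also have "\<dots> \<le> (\<Sum>\<^sub>\<infinity>J\<in>dyadic. (cmod (row_sum b d ?p J))\<^sup>2)"
    by (intro infsum_mono2 row summable_on_subset[OF row D] D) auto
  also have "\<dots> \<le> C\<^sup>2 * (\<Sum>\<^sub>\<infinity>I\<in>dyadic. (cmod (?p I))\<^sup>2)"
    by (rule row_sum_infsum_le[OF fb C p])
  also have "\<dots> \<le> C\<^sup>2 * (L2_norm f)\<^sup>2"
    by (intro mult_left_mono haar.Bessel_infsum fL) auto
  finally have "(L2_norm (Q_fun I u))\<^sup>2 \<le> C\<^sup>2 * (L2_norm (Q_seq I d))\<^sup>2"
    unfolding fn .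
  thus "\<exists>u\<in>L2. is_composition b d (Q_seq I (\<lambda>J. cnj (d J))) u \<and>
      (L2_norm (Q_fun I u))\<^sup>2 \<le> C\<^sup>2 * (L2_norm (Q_seq I d))\<^sup>2"
    by (intro bexI[OF _ uL] conjI comp[unfolded f_def])
qed

lemma dyadic_fmeasurable: "I \<in> dyadic \<Longrightarrow> I \<in> fmeasurable lborel"
  by (erule dyadic_intervalE) (simp add: fmeasurable_def)

text \<open>Each row is \<open>b J\<close> times a sum of the nonnegative terms |d_L|^2
  \<open>overlap L J\<close>. Keeping only \<open>L \<subseteq> J\<close>, where the overlap is 1 /
  |J|, leaves the inner sum of the testing condition. The terms to be summed over \<open>J\<close>
  are therefore dominated by squared Haar coefficients of an L2 function, which also yields the
  summability clause.\<close>

lemma operator_testing_imp_sum_testing: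
  assumes ot: "operator_testing b d C" and d: "locally_square_summable d"
  shows "sum_testing b d C"
  unfolding sum_testing_def
proof
  fix I assume I: "I \<in> dyadic"
  let ?D = "dyadic_below I"
  let ?t = "\<lambda>J. (cmod (b J))\<^sup>2 * (1 / (len J)\<^sup>2) * (\<Sum>\<^sub>\<infinity>L\<in>dyadic_below J. (cmod (d L))\<^sup>2)\<^sup>2"
  have D: "?D \<subseteq> dyadic" by (auto simp: dyadic_below_def)
  have dK: "(\<lambda>L. (cmod (d L))\<^sup>2) summable_on dyadic_below K" if "K \<in> dyadic" for K
    using d that by (auto simp: locally_square_summable_def)
  have dI': "(\<lambda>L. (cmod (cnj (d L)))\<^sup>2) summable_on ?D" using dK[OF I] by simp
  define f where "f = Q_seq I (\<lambda>J. cnj (d J))"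
  have fp: "pairing f (haar 0 J) = (if J \<in> ?D then cnj (d J) else 0)" if "J \<in> dyadic" for J
    unfolding f_def by (rule Q_seq_pairing[OF dI' that])
  obtain u where u: "u \<in> L2" "is_composition b d f u"
      "(L2_norm (Q_fun I u))\<^sup>2 \<le> C\<^sup>2 * (L2_norm (Q_seq I d))\<^sup>2"
    using ot I unfolding operator_testing_def f_def by blast
  have term_le: "?t J \<le> (cmod (pairing u (haar 0 J)))\<^sup>2" if "J \<in> ?D" for J
  proof -
    have J: "J \<in> dyadic" "J \<subseteq> I" using that by (auto simp: dyadic_below_def)
    let ?o = "\<lambda>L. (cmod (d L))\<^sup>2 * overlap L J"
    \<comment> \<open>Intervals \<open>L\<close> strictly containing \<open>J\<close> contribute to
      the row as well. As |L \<inter> J| is at most |L|, the overlap never exceeds 1 / |J|, so the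
      whole row converges.\<close>
    have o_le: "?o L \<le> (cmod (d L))\<^sup>2 * (1 / len J)" if "L \<in> ?D" for L
    proof (rule mult_left_mono)
      have L: "L \<in> dyadic" using that D by auto
      have "measure lborel (L \<inter> J) \<le> len L"
        by (rule measure_mono_fmeasurable)
           (use dyadic_fmeasurable[OF L] dyadic_fmeasurable[OF J(1)] in \<open>auto simp: fmeasurable_def\<close>)
      thus "overlap L J \<le> 1 / len J"
        using dyadic_len_pos[OF L] dyadic_len_pos[OF J(1)] by (simp add: overlap_def field_simps)
    qed simp
    have o: "?o summable_on ?D"
      by (rule summable_on_comparison_test[OF summable_on_cmult_left[OF dK[OF I]] o_le]) auto
    have "row_sum b d (\<lambda>I. pairing f (haar 0 I)) J = (\<Sum>\<^sub>\<infinity>L\<in>?D. b J * of_real (?o L))"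
      unfolding row_sum_def
    proof (rule infsum_cong_neutral)
      fix L assume "L \<in> dyadic \<inter> ?D"
      thus "b J * (d L * pairing f (haar 0 L) * of_real (overlap L J)) = b J * of_real (?o L)"
        by (simp add: fp complex_norm_square[symmetric])
    qed (use D in \<open>auto simp: fp\<close>)
    also have "\<dots> = b J * of_real (infsum ?o ?D)"
      by (intro infsumI has_sum_cmult_right has_sum_of_real has_sum_infsum o)
    finally have eq: "cmod (pairing u (haar 0 J)) = cmod (b J) * \<bar>infsum ?o ?D\<bar>"
      using composition_coefficient[OF u(2) J(1)] by (simp add: norm_mult)
    have le: "(\<Sum>\<^sub>\<infinity>L\<in>dyadic_below J. (cmod (d L))\<^sup>2) / len J \<le> infsum ?o ?D"
    proof -
      have "(\<Sum>\<^sub>\<infinity>L\<in>dyadic_below J. (cmod (d L))\<^sup>2) / len J = (\<Sum>\<^sub>\<infinity>L\<in>dyadic_below J. (cmod (d L))\<^sup>2 * (1 / len J))"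
        by (subst infsum_cmult_left') simp
      also have "\<dots> \<le> infsum ?o ?D"
        by (rule infsum_mono_neutral[OF summable_on_cmult_left[OF dK[OF J(1)]] o])
           (use J in \<open>auto simp: dyadic_below_def overlap_subset\<close>)
      finally show ?thesis .
    qed
    have nonneg: "0 \<le> (\<Sum>\<^sub>\<infinity>L\<in>dyadic_below J. (cmod (d L))\<^sup>2) / len J"
      by (intro divide_nonneg_nonneg infsum_nonneg) auto
    have "cmod (b J) * ((\<Sum>\<^sub>\<infinity>L\<in>dyadic_below J. (cmod (d L))\<^sup>2) / len J) \<le> cmod (pairing u (haar 0 J))"
      unfolding eq by (rule mult_left_mono[OF order_trans[OF le abs_ge_self] norm_ge_zero])
    hence "(cmod (b J) * ((\<Sum>\<^sub>\<infinity>L\<in>dyadic_below J. (cmod (d L))\<^sup>2) / len J))\<^sup>2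
        \<le> (cmod (pairing u (haar 0 J)))\<^sup>2"
      by (rule power_mono[OF _ mult_nonneg_nonneg[OF norm_ge_zero nonneg]])
    thus ?thesis by (simp add: power_mult_distrib power_divide mult_ac)
  qed
  note us = haar.Bessel_summable[OF u(1) D]
  have ts: "?t summable_on ?D"
    by (rule summable_on_comparison_test[OF us term_le]) auto
  moreover have "infsum ?t ?D \<le> (\<Sum>\<^sub>\<infinity>J\<in>?D. (cmod (pairing u (haar 0 J)))\<^sup>2)"
    by (rule infsum_mono[OF ts us term_le])
  with u(3) have "infsum ?t ?D \<le> C\<^sup>2 * (\<Sum>\<^sub>\<infinity>L\<in>?D. (cmod (d L))\<^sup>2)"
    unfolding Q_fun_L2_norm[OF u(1)] Q_seq_L2_norm[OF dK[OF I]] by linarith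
  ultimately show "?t summable_on ?D \<and> infsum ?t ?D \<le> C\<^sup>2 * (\<Sum>\<^sub>\<infinity>L\<in>?D. (cmod (d L))\<^sup>2)" ..
qed

lemma composition_bounded_by_imp_form_bounded:
  assumes "composition_bounded_by b d C"
  shows "0 \<le> C" and "form_bounded b d C"
proof -
  obtain T where T: "\<And>f. f \<in> L2 \<Longrightarrow> T f \<in> L2" "\<And>f. f \<in> L2 \<Longrightarrow> L2_norm (T f) \<le> C * L2_norm f"
    "\<And>f. f \<in> haar_span \<Longrightarrow> is_composition b d f (T f)"
    using assms unfolding composition_bounded_by_def by blast
  \<comment> \<open>A single function of norm one shows that \<open>C\<close> is nonnegative; the
    unit interval supplies it.\<close>
  have unit: "{0..<1} \<in> dyadic"
    unfolding dyadic_def by (intro CollectI exI[of _ 0]) simp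
  have "(L2_norm (haar 0 {0..<1}))\<^sup>2 = 1"
    using pairing_haar0_self[OF unit] unfolding pairing_self
    by (simp del: of_real_power)
  hence "(L2_norm (haar 0 {0..<1}))\<^sup>2 = 1\<^sup>2" by simp
  hence "L2_norm (haar 0 {0..<1}) = 1" by (rule power2_eq_imp_eq) simp_all
  hence "L2_norm (T (haar 0 {0..<1})) \<le> C" using T(2)[OF haar_L2[OF unit], of 0] by simp
  thus C: "0 \<le> C" by (rule order_trans[OF L2_norm_nonneg])
  show "form_bounded b d C"
    unfolding form_bounded_def
  proof (intro allI impI)
    fix G :: "real set set" and x y :: "real set \<Rightarrow> real"
    assume G: "finite G" "G \<subseteq> dyadic" and x: "\<forall>I. 0 \<le> x I" and y: "\<forall>J. 0 \<le> y J"
    \<comment> \<open>The conjugate phase turns \<open>d I * c I\<close> into |d_I| x_I. The phase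
      of \<open>b J\<close> is common to its row and disappears in the modulus.\<close>
    define c where "c I = of_real (x I) * cnj (sgn (d I))" for I
    define f where "f = (\<lambda>t. \<Sum>I\<in>G. c I * haar 0 I t)"
    define r where "r J = (\<Sum>I\<in>G. cmod (b J) * cmod (d I) * overlap I J * x I)" for J
    have r: "0 \<le> r J" for J unfolding r_def using x by (intro sum_nonneg) auto
    have fL: "f \<in> L2" unfolding f_def by (rule haar.sum_in_L2[OF G(2)])
    have fs: "f \<in> haar_span" unfolding haar_span_def f_def using G by blast
    have fp: "pairing f (haar 0 I) = (if I \<in> G then c I else 0)" if "I \<in> dyadic" for I
      unfolding f_def by (rule haar.pairing_sum[OF G that])
    have dc: "d I * c I = of_real (cmod (d I) * x I)" for I
      by (cases "d I = 0")
         (auto simp: c_def sgn_eq complex_norm_square[symmetric] power2_eq_square field_simps)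
    have row: "cmod (row_sum b d (\<lambda>I. pairing f (haar 0 I)) J) = r J" for J
    proof -
      have "row_sum b d (\<lambda>I. pairing f (haar 0 I)) J = (\<Sum>\<^sub>\<infinity>I\<in>G. b J * of_real (cmod (d I) * x I * overlap I J))"
        unfolding row_sum_def
        by (rule infsum_cong_neutral) (use G(2) in \<open>auto simp: fp dc\<close>)
      also have "\<dots> = b J * of_real (\<Sum>I\<in>G. cmod (d I) * x I * overlap I J)"
        using G(1) by (simp add: sum_distrib_left)
      finally have "cmod (row_sum b d (\<lambda>I. pairing f (haar 0 I)) J)
          = cmod (b J) * \<bar>\<Sum>I\<in>G. cmod (d I) * x I * overlap I J\<bar>"
        by (simp only: norm_mult norm_of_real)
      also have "\<bar>\<Sum>I\<in>G. cmod (d I) * x I * overlap I J\<bar> = (\<Sum>I\<in>G. cmod (d I) * x I * overlap I J)"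
        using x by (intro abs_of_nonneg sum_nonneg) auto
      finally show ?thesis by (simp add: r_def sum_distrib_left mult_ac)
    qed
    have "(\<Sum>J\<in>G. (r J)\<^sup>2) = (\<Sum>J\<in>G. (cmod (pairing (T f) (haar 0 J)))\<^sup>2)"
      using G(2) by (intro sum.cong refl) (simp add: composition_coefficient[OF T(3)[OF fs]] row subset_iff)
    also have "\<dots> \<le> (L2_norm (T f))\<^sup>2"
      by (rule haar.Bessel_finite[OF T(1)[OF fL] G])
    also have "\<dots> \<le> (C * L2_norm f)\<^sup>2"
      by (intro power_mono T fL) simp
    also have "\<dots> = C\<^sup>2 * (\<Sum>I\<in>G. (cmod (c I))\<^sup>2)"
      unfolding f_def power_mult_distrib haar.L2_norm_sum[OF G] ..
    \<comment> \<open>An inequality only, because \<open>sgn 0 = 0\<close> makes \<open>c I\<close>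
      vanish where \<open>d I = 0\<close>.\<close>
    also have "\<dots> \<le> C\<^sup>2 * (\<Sum>I\<in>G. (x I)\<^sup>2)"
      using x by (intro mult_left_mono sum_mono power_mono) (auto simp: c_def norm_mult norm_sgn)
    finally have "L2_set r G \<le> sqrt (C\<^sup>2 * (\<Sum>I\<in>G. (x I)\<^sup>2))"
      unfolding L2_set_def by simp
    also have "\<dots> = C * L2_set x G"
      using C by (simp add: L2_set_def real_sqrt_mult)
    finally have rs: "L2_set r G \<le> C * L2_set x G" .
    have "(\<Sum>J\<in>G. \<Sum>I\<in>G. cmod (b J) * cmod (d I) * overlap I J * x I * y J) = (\<Sum>J\<in>G. \<bar>r J\<bar> * \<bar>y J\<bar>)"
      using r y by (simp add: r_def sum_distrib_right)
    also have "\<dots> \<le> L2_set r G * L2_set y G" by (rule L2_set_mult_ineq)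
    also have "\<dots> \<le> C * L2_set x G * L2_set y G" by (intro mult_right_mono rs) simp
    finally show "(\<Sum>J\<in>G. \<Sum>I\<in>G. cmod (b J) * cmod (d I) * overlap I J * x I * y J)
        \<le> C * L2_set x G * L2_set y G" .
  qed
qed

text \<open>The extension is defined on all of L2 by prescribing Haar coefficients, so it makes
  sense even where no intermediate function is at hand. On finite Haar combinations the inner series
  has finitely many nonzero terms, and there the extension is the actual composition.\<close>

lemma form_bounded_imp_composition_bounded_by:
  assumes fb: "form_bounded b d C" and C: "0 \<le> C"
  shows "composition_bounded_by b d C"
proof -
  define R where "R f = row_sum b d (\<lambda>I. pairing f (haar 0 I))" for f
  define T where "T f = (SOME u. has_L2_sum (\<lambda>J x. R f J * haar 0 J x) dyadic u)" for f
  note p = haar.Bessel_summable[OF _ order_refl]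
  have T: "has_L2_sum (\<lambda>J x. R f J * haar 0 J x) dyadic (T f)" if f: "f \<in> L2" for f
  proof -
    have "(\<lambda>J. (cmod (R f J))\<^sup>2) summable_on dyadic"
      unfolding R_def by (rule row_sum_square_summable[OF fb C p[OF f]])
    hence "\<exists>u. has_L2_sum (\<lambda>J x. R f J * haar 0 J x) dyadic u"
      using haar.Riesz_Fischer[OF _ order_refl] by blast
    thus ?thesis unfolding T_def by (rule someI_ex)
  qed
  have norm: "L2_norm (T f) \<le> C * L2_norm f" if f: "f \<in> L2" for f
  proof (rule power2_le_imp_le)
    have "(L2_norm (T f))\<^sup>2 = (\<Sum>\<^sub>\<infinity>J\<in>dyadic. (cmod (R f J))\<^sup>2)"
      using haar.has_L2_sum_norm[OF T[OF f] order_refl] by (rule infsumI[symmetric])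
    also have "\<dots> \<le> C\<^sup>2 * (\<Sum>\<^sub>\<infinity>I\<in>dyadic. (cmod (pairing f (haar 0 I)))\<^sup>2)"
      unfolding R_def by (rule row_sum_infsum_le[OF fb C p[OF f]])
    also have "\<dots> \<le> C\<^sup>2 * (L2_norm f)\<^sup>2"
      by (intro mult_left_mono haar.Bessel_infsum f) auto
    finally show "(L2_norm (T f))\<^sup>2 \<le> (C * L2_norm f)\<^sup>2" by (simp add: power_mult_distrib)
  qed (use C in simp)
  have linear: "AE x in lborel. T (\<lambda>y. a * f y + g y) x = a * T f x + T g x"
    if f: "f \<in> L2" and g: "g \<in> L2" for f g a
  proof -
    let ?h = "\<lambda>y. a * f y + g y"
    have h: "?h \<in> L2" by (intro L2_add L2_scale f g)
    \<comment> \<open>Additivity of the infinite sums rests on the convergence of every row, for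
      \<open>f\<close> and for \<open>g\<close>, which boundedness of the form guarantees.\<close>
    have Rh: "R ?h J = a * R f J + R g J" if J: "J \<in> dyadic" for J
    proof -
      let ?r = "\<lambda>f I. b J * (d I * pairing f (haar 0 I) * of_real (overlap I J))"
      have "((\<lambda>I. a * ?r f I + ?r g I) has_sum a * infsum (?r f) dyadic + infsum (?r g) dyadic) dyadic"
        by (intro has_sum_add has_sum_cmult_right has_sum_infsum row_summable[OF fb C p] f g J)
      moreover have "a * ?r f I + ?r g I = ?r ?h I" if "I \<in> dyadic" for I
        using that f g
        by (simp add: pairing_add_left L2_scale haar_L2 pairing_scale_left algebra_simps)
      ultimately have "(?r ?h has_sum a * infsum (?r f) dyadic + infsum (?r g) dyadic) dyadic"
        by (subst has_sum_cong[where g = "\<lambda>I. a * ?r f I + ?r g I"]) auto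
      thus ?thesis unfolding R_def row_sum_def by (rule infsumI)
    qed
    have "has_L2_sum (\<lambda>J x. a * (R f J * haar 0 J x) + R g J * haar 0 J x) dyadic (\<lambda>x. a * T f x + T g x)"
      by (rule has_L2_sum_linear[OF L2_scale L2_scale T[OF f] T[OF g]]) (auto intro: haar_L2)
    hence "has_L2_sum (\<lambda>J x. R ?h J * haar 0 J x) dyadic (\<lambda>x. a * T f x + T g x)"
      by (rule has_L2_sum_cong[THEN iffD1, rotated]) (simp add: Rh distrib_right mult.assoc)
    from has_L2_sum_unique[OF L2_scale[OF haar_L2] T[OF h] this] show ?thesis by simp
  qed
  have comp: "is_composition b d f (T f)" if fs: "f \<in> haar_span" for f
  proof -
    obtain F c where F: "finite F" "F \<subseteq> dyadic" and f: "f = (\<lambda>x. \<Sum>J\<in>F. c J * haar 0 J x)"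
      using fs by (auto simp: haar_span_def)
    have fL: "f \<in> L2" unfolding f by (rule haar.sum_in_L2[OF F(2)])
    have "pairing f (haar 0 I) = 0" if "I \<in> dyadic - F" for I
      unfolding f using that haar.pairing_sum[OF F, of I c] by auto
    hence "(\<lambda>I. cmod (d I * pairing f (haar 0 I))) summable_on dyadic \<longleftrightarrow>
        (\<lambda>I. cmod (d I * pairing f (haar 0 I))) summable_on F"
      using F(2) by (intro summable_on_cong_neutral) auto
    hence "(\<lambda>I. cmod (d I * pairing f (haar 0 I))) summable_on dyadic" using F(1) by simp
    thus ?thesis by (rule compositionI[OF _ T[OF fL, unfolded R_def]])
  qed
  show ?thesis
    unfolding composition_bounded_by_def
    using has_L2_sum_in_L2[OF T] norm linear comp by (intro exI[of _ T]) blast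
qed

section \<open>Best constants and the operator norm\<close>

lemma best_constant_le: "0 \<le> C \<Longrightarrow> P C \<Longrightarrow> best_constant P \<le> C"
  unfolding best_constant_def by (intro cInf_lower) (auto intro: bdd_belowI[of _ 0])

text \<open>A witness for \<open>P\<close> is demanded because the infimum of the empty set of reals
  carries no information.\<close>

lemma best_constant_mono:
  assumes "\<And>C. 0 \<le> C \<Longrightarrow> P C \<Longrightarrow> Q C" "0 \<le> C" "P C"
  shows "best_constant Q \<le> best_constant P"
  unfolding best_constant_def using assms by (intro cInf_superset_mono) (auto intro: bdd_belowI[of _ 0])

lemma best_constant_approx:
  assumes "0 \<le> C" "P C" "best_constant P < e"
  obtains C' where "0 \<le> C'" "P C'" "C' < e"
proof -
  have "{C. 0 \<le> C \<and> P C} \<noteq> {}" using assms by blast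
  from cInf_lessD[OF this] assms(3) show thesis
    unfolding best_constant_def using that by blast
qed

lemma composition_norm_eq: "composition_norm b d = best_constant (composition_bounded_by b d)"
  by (simp add: composition_norm_def best_constant_def)

lemma composition_bounded_by_imp_operator_testing:
  assumes "composition_bounded_by b d C" "locally_square_summable b" "locally_square_summable d"
  shows "operator_testing b d C" "operator_testing d b C"
proof -
  note fb = composition_bounded_by_imp_form_bounded[OF assms(1)]
  show "operator_testing b d C"
    by (rule form_bounded_imp_operator_testing[OF fb(2,1) assms(3)])
  show "operator_testing d b C"
    by (rule form_bounded_imp_operator_testing[OF form_bounded_commute[OF fb(2)] fb(1) assms(2)])
qed

lemma sum_testing_imp_composition_bounded_by:
  assumes "locally_square_summable b" "locally_square_summable d" "sum_testing b d C\<^sub>1" "sum_testing d b C\<^sub>2"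
  shows "composition_bounded_by b d (2 * (\<bar>C\<^sub>1\<bar> + \<bar>C\<^sub>2\<bar>))"
  by (intro form_bounded_imp_composition_bounded_by sum_testing_imp_form_bounded assms) simp

text \<open>A bound for the composition is a constant for both operator conditions, and a constant
  for an operator condition is one for the corresponding sum condition. The infima are ordered
  accordingly, and the last estimate closes the circle.\<close>

lemma composition_norm_bounds:
  assumes b: "locally_square_summable b" and d: "locally_square_summable d"
    and cb: "composition_bounded b d"
  defines "o\<^sub>1 \<equiv> best_constant (operator_testing b d)" and "o\<^sub>2 \<equiv> best_constant (operator_testing d b)"
    and "s\<^sub>1 \<equiv> best_constant (sum_testing b d)" and "s\<^sub>2 \<equiv> best_constant (sum_testing d b)"
  shows "o\<^sub>1 \<le> composition_norm b d" "o\<^sub>2 \<le> composition_norm b d"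
    and "s\<^sub>1 \<le> o\<^sub>1" "s\<^sub>2 \<le> o\<^sub>2"
    and "composition_norm b d \<le> 2 * (s\<^sub>1 + s\<^sub>2)"
proof -
  obtain C where C: "composition_bounded_by b d C" using cb by (auto simp: composition_bounded_def)
  note C0 = composition_bounded_by_imp_form_bounded(1)[OF C]
  note oC = composition_bounded_by_imp_operator_testing[OF C b d]
  note sC = operator_testing_imp_sum_testing[OF oC(1) d] operator_testing_imp_sum_testing[OF oC(2) b]
  show "o\<^sub>1 \<le> composition_norm b d" "o\<^sub>2 \<le> composition_norm b d"
    unfolding o\<^sub>1_def o\<^sub>2_def composition_norm_eq
    using C0 C
    by (auto intro: best_constant_mono[of "composition_bounded_by b d"]
          composition_bounded_by_imp_operator_testing[OF _ b d])
  show "s\<^sub>1 \<le> o\<^sub>1" "s\<^sub>2 \<le> o\<^sub>2"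
    unfolding o\<^sub>1_def o\<^sub>2_def s\<^sub>1_def s\<^sub>2_def
    using C0 oC
    by (auto intro: best_constant_mono[of "operator_testing b d"] best_constant_mono[of "operator_testing d b"]
          operator_testing_imp_sum_testing[OF _ d] operator_testing_imp_sum_testing[OF _ b])
  show "composition_norm b d \<le> 2 * (s\<^sub>1 + s\<^sub>2)"
  proof (rule field_le_epsilon)
    \<comment> \<open>Near-optimal constants are used, as infima. Two errors of e / 4, doubled by
      the factor of the Hardy inequality, add up to e.\<close>
    fix e :: real assume e: "0 < e"
    obtain C1 where C1: "0 \<le> C1" "sum_testing b d C1" "C1 < s\<^sub>1 + e / 4"
      using best_constant_approx[of C "sum_testing b d" "s\<^sub>1 + e / 4"] C0 sC(1) e
      unfolding s\<^sub>1_def by auto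
    obtain C2 where C2: "0 \<le> C2" "sum_testing d b C2" "C2 < s\<^sub>2 + e / 4"
      using best_constant_approx[of C "sum_testing d b" "s\<^sub>2 + e / 4"] C0 sC(2) e
      unfolding s\<^sub>2_def by auto
    have "composition_norm b d \<le> 2 * (\<bar>C1\<bar> + \<bar>C2\<bar>)"
      unfolding composition_norm_eq
      by (intro best_constant_le sum_testing_imp_composition_bounded_by b d C1 C2) simp
    thus "composition_norm b d \<le> 2 * (s\<^sub>1 + s\<^sub>2) + e" using C1 C2 by simp
  qed
qed

theorem theorem1p4:
  "(\<forall>b d :: real set \<Rightarrow> complex. locally_square_summable b \<longrightarrow> locally_square_summable d \<longrightarrow>
      (composition_bounded b d \<longleftrightarrow>
         (\<exists>C\<^sub>1 C\<^sub>2. operator_testing b d C\<^sub>1 \<and> operator_testing d b C\<^sub>2)) \<and>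
      ((\<exists>C\<^sub>1 C\<^sub>2. operator_testing b d C\<^sub>1 \<and> operator_testing d b C\<^sub>2) \<longleftrightarrow>
         (\<exists>C\<^sub>1 C\<^sub>2. sum_testing b d C\<^sub>1 \<and> sum_testing d b C\<^sub>2))) \<and>
   (\<exists>c C :: real. 0 < c \<and> c \<le> C \<and>
      (\<forall>b d :: real set \<Rightarrow> complex. locally_square_summable b \<longrightarrow> locally_square_summable d \<longrightarrow>
         composition_bounded b d \<longrightarrow>
           c * (best_constant (operator_testing b d) + best_constant (operator_testing d b))
             \<le> composition_norm b d \<and>
           composition_norm b d
             \<le> C * (best_constant (operator_testing b d) + best_constant (operator_testing d b)) \<and>
           c * (best_constant (sum_testing b d) + best_constant (sum_testing d b))
             \<le> composition_norm b d \<and>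
           composition_norm b d
             \<le> C * (best_constant (sum_testing b d) + best_constant (sum_testing d b))))"
proof (intro conjI allI impI)
  fix b d :: "real set \<Rightarrow> complex"
  assume b: "locally_square_summable b" and d: "locally_square_summable d"
  have 1: "\<exists>C\<^sub>1 C\<^sub>2. operator_testing b d C\<^sub>1 \<and> operator_testing d b C\<^sub>2" if "composition_bounded b d"
    using that composition_bounded_by_imp_operator_testing[OF _ b d]
    by (auto simp: composition_bounded_def)
  have 2: "\<exists>C\<^sub>1 C\<^sub>2. sum_testing b d C\<^sub>1 \<and> sum_testing d b C\<^sub>2"
    if "\<exists>C\<^sub>1 C\<^sub>2. operator_testing b d C\<^sub>1 \<and> operator_testing d b C\<^sub>2"
    using that operator_testing_imp_sum_testing[OF _ d] operator_testing_imp_sum_testing[OF _ b] by blast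
  have 3: "composition_bounded b d" if "\<exists>C\<^sub>1 C\<^sub>2. sum_testing b d C\<^sub>1 \<and> sum_testing d b C\<^sub>2"
    using that sum_testing_imp_composition_bounded_by[OF b d] by (auto simp: composition_bounded_def)
  show "composition_bounded b d \<longleftrightarrow> (\<exists>C\<^sub>1 C\<^sub>2. operator_testing b d C\<^sub>1 \<and> operator_testing d b C\<^sub>2)"
    using 1 2 3 by blast
  show "(\<exists>C\<^sub>1 C\<^sub>2. operator_testing b d C\<^sub>1 \<and> operator_testing d b C\<^sub>2) \<longleftrightarrow>
      (\<exists>C\<^sub>1 C\<^sub>2. sum_testing b d C\<^sub>1 \<and> sum_testing d b C\<^sub>2)"
    using 1 2 3 by blast
next
  show "\<exists>c C :: real. 0 < c \<and> c \<le> C \<and>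
      (\<forall>b d :: real set \<Rightarrow> complex. locally_square_summable b \<longrightarrow> locally_square_summable d \<longrightarrow>
         composition_bounded b d \<longrightarrow>
           c * (best_constant (operator_testing b d) + best_constant (operator_testing d b))
             \<le> composition_norm b d \<and>
           composition_norm b d
             \<le> C * (best_constant (operator_testing b d) + best_constant (operator_testing d b)) \<and>
           c * (best_constant (sum_testing b d) + best_constant (sum_testing d b))
             \<le> composition_norm b d \<and>
           composition_norm b d
             \<le> C * (best_constant (sum_testing b d) + best_constant (sum_testing d b)))"
  \<comment> \<open>Each best constant is at most the norm, so half the sum of two of them is too.
    The upper constant is that of the Hardy inequality, and it passes to the operator conditions
    because their best constants dominate those of the sum conditions.\<close>
  proof (rule exI[of _ "1/2"], rule exI[of _ 2], intro conjI allI impI)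
    fix b d :: "real set \<Rightarrow> complex"
    assume *: "locally_square_summable b" "locally_square_summable d" "composition_bounded b d"
    note le = composition_norm_bounds[OF *]
    show "1 / 2 * (best_constant (operator_testing b d) + best_constant (operator_testing d b)) \<le> composition_norm b d"
      "composition_norm b d \<le> 2 * (best_constant (operator_testing b d) + best_constant (operator_testing d b))"
      "1 / 2 * (best_constant (sum_testing b d) + best_constant (sum_testing d b)) \<le> composition_norm b d"
      "composition_norm b d \<le> 2 * (best_constant (sum_testing b d) + best_constant (sum_testing d b))"
      using le by auto
  qed auto
qed

end
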